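(* Let $1<p<\infty$, let $f_+\in H_p^+\setminus\{0\}$ with inner-outer factorization $f_+=I_+O_+$ ($I_+$ inner, $O_+$ outer in $H_p^+$), and let $Q$ be an outer function which is bounded away from zero and satisfies $Qf_+\in H_p^+$. Then the minimal kernel $K_{\min}^Q(f_+)$ (the smallest kernel containing $f_+$ among kernels of Toeplitz operators with symbol in $\sigma_Q$) exists and $$K_{\min}^Q(f_+)=\ker T_{\overline{Q}\,\frac{\overline{I_+}\,\overline{O_+}}{O_+}} .$$
   Context: $L_p=L^p(\mathbb R)$; $H_p^+=H^p(\mathbb C^+)$ is the Hardy space of the upper half-plane and $H_p^-=\overline{H_p^+}=H^p(\mathbb C^-)$, both identified with closed subspaces of $L_p$ via boundary values; $P^+$ is the (Riesz) projection of $L_p$ onto $H_p^+$ parallel to $H_p^-$. For a measurable function $g$ on $\mathbb R$ for which there exists $\phi\in H_p^+\setminus\{0\}$ with $g\phi\in L_p$, the (possibly unbounded) Toeplitz operator $T_g$ has domain $D(T_g)=\{\phi_+\in H_p^+: g\phi_+\in L_p\}$ and $T_g\phi_+=P^+(g\phi_+)$; thus $\ker T_g=\{\phi_+\in H_p^+: g\phi_+\in H_p^-\}$. "Outer function" for $Q$ is meant in the general (Smirnov class) sense: $Q(\xi)=c\exp\left(\frac{1}{i\pi}\int_{\mathbb R}\frac{\log W(t)}{1+t^2}\frac{1+t\xi}{t-\xi}\,dt\right)$ with $|c|=1$, $W=|Q|$ and $\int_{\mathbb R}\frac{|\log W(t)|}{1+t^2}dt<\infty$. $\sigma_Q$ is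 the class of measurable symbols $h$ on $\mathbb R$ such that $|h|<c|Q|$ a.e. on $\mathbb R$ for some constant $c>0$. $K_{\min}^Q(f_+)$ denotes a kernel $\ker T_k$ with $k\in\sigma_Q$ and $f_+\in\ker T_k$ such that $\ker T_k\subset\ker T_h$ for every $h\in\sigma_Q$ with $f_+\in\ker T_h$. *)

theory Defs
  imports "HOL-Analysis.Analysis"
begin

text \<open>
  Elements of the function spaces are represented by functions on the real line.  All the sets of
  functions below are closed under changing a function on a Lebesgue null set, so equality and
  inclusion of such sets is the same as equality and inclusion of the corresponding sets of
  almost-everywhere classes.
\<close>

definition upper_half_plane :: "complex set" where
  "upper_half_plane = {z. Im z > 0}"

text \<open>Non-tangential boundary values: limits in every cone with vertex on the real line.\<close>

definition boundary_values :: "(complex \<Rightarrow> complex) \<Rightarrow> (real \<Rightarrow> complex) \<Rightarrow> bool" where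
  "boundary_values F f \<longleftrightarrow>
     (AE x in lebesgue. \<forall>a>0.
        (F \<longlongrightarrow> f x) (at (complex_of_real x) within {z. 0 < Im z \<and> \<bar>Re z - x\<bar> < a * Im z}))"

definition Lp :: "real \<Rightarrow> (real \<Rightarrow> complex) set" where
  "Lp p = {f \<in> borel_measurable lebesgue. integrable lebesgue (\<lambda>x. norm (f x) powr p)}"

definition Hardy :: "real \<Rightarrow> (complex \<Rightarrow> complex) set" where
  "Hardy p = {F. F holomorphic_on upper_half_plane \<and>
     (SUP y\<in>{0<..}. \<integral>\<^sup>+x. ennreal (norm (F (Complex x y)) powr p) \<partial>lebesgue) < \<infinity>}"

definition Hp_plus :: "real \<Rightarrow> (real \<Rightarrow> complex) set" where
  "Hp_plus p = {f \<in> Lp p. \<exists>F\<in>Hardy p. boundary_values F f}"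

definition Hp_minus :: "real \<Rightarrow> (real \<Rightarrow> complex) set" where
  "Hp_minus p = {f. (\<lambda>x. cnj (f x)) \<in> Hp_plus p}"

definition inner_function :: "(real \<Rightarrow> complex) \<Rightarrow> bool" where
  "inner_function f \<longleftrightarrow>
     f \<in> borel_measurable lebesgue \<and> (AE x in lebesgue. norm (f x) = 1) \<and>
     (\<exists>F. F holomorphic_on upper_half_plane \<and> bounded (F ` upper_half_plane) \<and> boundary_values F f)"

text \<open>
  The general (Smirnov class) notion of outer function.  Since \<open>ln 0 = 0\<close> in HOL, integrability of
  the logarithm of the modulus does not entail that the modulus is positive almost everywhere,
  which is therefore required separately.
\<close>

definition outer_function :: "(real \<Rightarrow> complex) \<Rightarrow> bool" where
  "outer_function q \<longleftrightarrow>
     q \<in> borel_measurable lebesgue \<and> (AE t in lebesgue. q t \<noteq> 0) \<and>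
     integrable lebesgue (\<lambda>t. \<bar>ln (norm (q t))\<bar> / (1 + t\<^sup>2)) \<and>
     (\<exists>c. norm c = 1 \<and>
        boundary_values
          (\<lambda>\<xi>. c * exp (1 / (\<i> * complex_of_real pi) *
             (\<integral>t. complex_of_real (ln (norm (q t)) / (1 + t\<^sup>2)) *
                  ((1 + complex_of_real t * \<xi>) / (complex_of_real t - \<xi>)) \<partial>lebesgue)))
          q)"

text \<open>
  Operators are given by their graphs, as values are only determined up to null sets.
  The Riesz projection is the projection onto \<open>Hp_plus p\<close> parallel to \<open>Hp_minus p\<close>:
  \<open>riesz_projection p f u\<close> means that \<open>u\<close> represents the projection of \<open>f\<close>.
\<close>

definition riesz_projection :: "real \<Rightarrow> (real \<Rightarrow> complex) \<Rightarrow> (real \<Rightarrow> complex) \<Rightarrow> bool" where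
  "riesz_projection p f u \<longleftrightarrow> f \<in> Lp p \<and> u \<in> Hp_plus p \<and> (\<lambda>x. f x - u x) \<in> Hp_minus p"

definition toeplitz_symbol :: "real \<Rightarrow> (real \<Rightarrow> complex) \<Rightarrow> bool" where
  "toeplitz_symbol p g \<longleftrightarrow>
     g \<in> borel_measurable lebesgue \<and>
     (\<exists>\<phi>\<in>Hp_plus p. \<not> (AE x in lebesgue. \<phi> x = 0) \<and> (\<lambda>x. g x * \<phi> x) \<in> Lp p)"

definition toeplitz_domain :: "real \<Rightarrow> (real \<Rightarrow> complex) \<Rightarrow> (real \<Rightarrow> complex) set" where
  "toeplitz_domain p g = {\<phi> \<in> Hp_plus p. (\<lambda>x. g x * \<phi> x) \<in> Lp p}"

definition toeplitz :: "real \<Rightarrow> (real \<Rightarrow> complex) \<Rightarrow> (real \<Rightarrow> complex) \<Rightarrow> (real \<Rightarrow> complex) \<Rightarrow> bool" where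
  "toeplitz p g \<phi> \<psi> \<longleftrightarrow>
     \<phi> \<in> toeplitz_domain p g \<and> riesz_projection p (\<lambda>x. g x * \<phi> x) \<psi>"

definition toeplitz_kernel :: "real \<Rightarrow> (real \<Rightarrow> complex) \<Rightarrow> (real \<Rightarrow> complex) set" where
  "toeplitz_kernel p g = {\<phi>. toeplitz p g \<phi> (\<lambda>_. 0)}"

definition sigma_class :: "(real \<Rightarrow> complex) \<Rightarrow> (real \<Rightarrow> complex) set" where
  "sigma_class Q = {h \<in> borel_measurable lebesgue.
     \<exists>c>0. AE x in lebesgue. norm (h x) < c * norm (Q x)}"

definition is_min_kernel ::
    "real \<Rightarrow> (real \<Rightarrow> complex) \<Rightarrow> (real \<Rightarrow> complex) \<Rightarrow> (real \<Rightarrow> complex) set \<Rightarrow> bool" where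
  "is_min_kernel p Q f K \<longleftrightarrow>
     (\<exists>k\<in>sigma_class Q. toeplitz_symbol p k \<and> K = toeplitz_kernel p k) \<and> f \<in> K \<and>
     (\<forall>h\<in>sigma_class Q. toeplitz_symbol p h \<longrightarrow> f \<in> toeplitz_kernel p h \<longrightarrow> K \<subseteq> toeplitz_kernel p h)"

text \<open>There is at most one minimal kernel, by antisymmetry of inclusion.\<close>

definition K_min ::
    "real \<Rightarrow> (real \<Rightarrow> complex) \<Rightarrow> (real \<Rightarrow> complex) \<Rightarrow> (real \<Rightarrow> complex) set" where
  "K_min p Q f = (THE K. is_min_kernel p Q f K)"

end

(*
  Let k be the symbol in the statement. Since |k| = |Q| and k f = cnj (Q O) almost everywhere, f lies in
  ker T_k as soon as Q O is in H^p. If h is in the class sigma_Q with h f = cnj g, and k phi = cnj psi,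
  where g and psi are in H^p, then h phi = cnj (g psi / (Q O)), which is in L^p because |h| <= c |k|.
  So minimality is the Smirnov maximum principle: the quotient of a product of two H^p functions by an
  outer function is in H^p as soon as its boundary function is in L^p. For this, the modulus of the
  product is bounded by the exponential of the Poisson integral of the logarithm of its boundary modulus.
  On a shifted half-plane, where the product is bounded and continuous, the bound follows from the
  Phragmen-Lindeloef principle after division by an outer function of the same boundary modulus. The
  shift is then removed by dominated convergence, and Jensen's inequality and Tonelli's theorem turn
  the bound into one for the H^p norm.
*)

theory Submission
  imports Defs "HOL-Probability.Sinc_Integral" "HOL-Complex_Analysis.Complex_Analysis"
begin

section \<open>Poisson and Schwarz integrals\<close>

text \<open>The symbol is built so that \<open>cnj (k x * f_plus x)\<close> is
  \<open>Q x * O_plus x\<close>, with no inner factor left. An outer denominator is harmless: its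
  extension has no zeros, and the logarithm of its modulus equals the Poisson integral of its
  boundary values, so division subtracts exactly ln |Q| + ln |O| under the integral. For an inner
  factor only an inequality would hold, in the wrong direction. The product of two H^p functions is
  controlled only in H^(p/2), where p/2 may be below 1; an upper bound for the logarithm of the
  modulus makes sense for every exponent. The obstacle is then the passage to the real line: the
  logarithms on the shifted lines have no common majorant, neither near zeros nor near large values.
  They are therefore truncated at -ln A and ln A. Truncation from below only raises the bound, and
  the part cut off above contributes at most a multiple of A^(-r), uniformly in the shift, because
  the means of order r are bounded. So the shift can tend to zero at fixed A, and A to infinity
  afterwards.\<close>

definition poisson_kernel :: "complex \<Rightarrow> real \<Rightarrow> real" where
  "poisson_kernel z t = Im z / (pi * (norm (complex_of_real t - z))\<^sup>2)"

text \<open>The exponent in \<open>outer_function\<close>. The kernel together with the weight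
  equals 1/(t - \<xi>) - t/(1 + t^2), the Cauchy kernel regularised at infinity, so that
  integrability of v against 1/(1 + t^2) is enough for convergence.\<close>

definition schwarz_integral :: "(real \<Rightarrow> real) \<Rightarrow> complex \<Rightarrow> complex" where
  "schwarz_integral v \<xi> = 1 / (\<i> * complex_of_real pi) *
     (\<integral>t. complex_of_real (v t / (1 + t\<^sup>2)) *
        ((1 + complex_of_real t * \<xi>) / (complex_of_real t - \<xi>)) \<partial>lebesgue)"

lemma mem_upper_half_plane [simp]: "z \<in> upper_half_plane \<longleftrightarrow> 0 < Im z"
  by (simp add: upper_half_plane_def)

lemma open_upper_half_plane: "open upper_half_plane"
  by (simp add: upper_half_plane_def open_halfspace_Im_gt)

lemma convex_upper_half_plane: "convex upper_half_plane"
  by (simp add: upper_half_plane_def convex_halfspace_Im_gt)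

lemma poisson_kernel_eq:
  "poisson_kernel z t = Im z / (pi * ((t - Re z)\<^sup>2 + (Im z)\<^sup>2))"
  by (simp add: poisson_kernel_def cmod_power2)

lemma borel_measurable_poisson_kernel [measurable]: "poisson_kernel z \<in> borel_measurable borel"
  unfolding poisson_kernel_eq[abs_def] by measurable

lemma borel_measurable_poisson_kernel_lebesgue [measurable]:
  "poisson_kernel z \<in> borel_measurable lebesgue"
  using borel_measurable_poisson_kernel by (simp add: borel_measurable_subalgebra measurable_completion)

lemma poisson_kernel_nonneg: "0 \<le> Im z \<Longrightarrow> 0 \<le> poisson_kernel z t"
  by (simp add: poisson_kernel_def)

lemma Im_le_norm_real_diff: "Im z \<le> norm (complex_of_real t - z)"
  using abs_Im_le_cmod[of "complex_of_real t - z"] by simp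

lemma one_plus_square_le_norm_real_diff:
  assumes "0 < Im z"
  obtains C where "0 < C" "\<And>t. 1 + t\<^sup>2 \<le> C * (norm (complex_of_real t - z))\<^sup>2"
proof
  \<comment> \<open>\<open>D\<close> makes D * (Im z)^2 equal to the constant term 1 + 2 |z|^2,
    which (Im z)^2 <= |t - z|^2 then turns into a multiple of |t - z|^2.\<close>
  define D where "D = (1 + 2 * (norm z)\<^sup>2) / (Im z)\<^sup>2"
  have D: "D \<ge> 0" by (simp add: D_def)
  then show "0 < 2 + D" by simp
  fix t
  let ?r = "norm (complex_of_real t - z)"
  have "\<bar>t\<bar> \<le> ?r + norm z"
    using norm_triangle_ineq[of "complex_of_real t - z" z] by simp
  then have "t\<^sup>2 \<le> (?r + norm z)\<^sup>2"
    using power_mono[of "\<bar>t\<bar>" "?r + norm z" 2] by simp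
  also have "\<dots> \<le> 2 * ?r\<^sup>2 + 2 * (norm z)\<^sup>2"
    using sum_squares_bound[of ?r "norm z"] by (simp add: power2_sum)
  finally have 1: "1 + t\<^sup>2 \<le> 2 * ?r\<^sup>2 + D * (Im z)\<^sup>2"
    using assms by (simp add: D_def)
  have "(Im z)\<^sup>2 \<le> ?r\<^sup>2"
    using assms Im_le_norm_real_diff[of z t] by (intro power_mono) auto
  then have "D * (Im z)\<^sup>2 \<le> D * ?r\<^sup>2" using D by (rule mult_left_mono)
  with 1 show "1 + t\<^sup>2 \<le> (2 + D) * ?r\<^sup>2" by (simp add: algebra_simps)
qed

text \<open>This lets the single weight 1/(1 + t^2) of the definition of outer functions give
  integrability against the Poisson kernel of every point.\<close>

lemma poisson_kernel_le:
  assumes "0 < Im z"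
  obtains C where "0 < C" "\<And>t. poisson_kernel z t \<le> C / (1 + t\<^sup>2)"
proof -
  obtain C where C: "0 < C" "\<And>t. 1 + t\<^sup>2 \<le> C * (norm (complex_of_real t - z))\<^sup>2"
    using one_plus_square_le_norm_real_diff[OF assms] by blast
  show thesis
  proof
    show "0 < Im z * C / pi" using assms C by simp
    fix t
    have p: "0 < (norm (complex_of_real t - z))\<^sup>2"
      using assms Im_le_norm_real_diff[of z t] by auto
    have "1 + t\<^sup>2 > 0" by (simp add: add_pos_nonneg)
    then have "1 / (norm (complex_of_real t - z))\<^sup>2 \<le> C / (1 + t\<^sup>2)"
      using p C(2)[of t] by (simp add: divide_simps)
    then have "Im z / pi * (1 / (norm (complex_of_real t - z))\<^sup>2) \<le> Im z / pi * (C / (1 + t\<^sup>2))"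
      using assms by (intro mult_left_mono) auto
    then show "poisson_kernel z t \<le> Im z * C / pi / (1 + t\<^sup>2)"
      by (simp add: poisson_kernel_def mult.commute)
  qed
qed

lemma poisson_kernel_le_const:
  assumes "0 < Im z"
  shows "poisson_kernel z t \<le> 1 / (pi * Im z)"
proof -
  have "(Im z)\<^sup>2 \<le> (norm (complex_of_real t - z))\<^sup>2"
    using assms Im_le_norm_real_diff[of z t] by (intro power_mono) auto
  then have "poisson_kernel z t \<le> Im z / (pi * (Im z)\<^sup>2)"
    unfolding poisson_kernel_def using assms
    by (intro divide_left_mono mult_left_mono mult_pos_pos) (auto intro: less_le_trans[rotated])
  then show ?thesis using assms by (simp add: power2_eq_square)
qed

lemma poisson_kernel_affine:
  assumes "0 < Im z"
  shows "Im z * poisson_kernel z (Re z + Im z * s) = 1 / (pi * (1 + s\<^sup>2))"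
proof -
  have "(Im z * s)\<^sup>2 + (Im z)\<^sup>2 = (Im z)\<^sup>2 * (1 + s\<^sup>2)" by (simp add: algebra_simps power_mult_distrib)
  then show ?thesis using assms unfolding poisson_kernel_eq by (simp add: power2_eq_square)
qed

lemma has_bochner_integral_cauchy_density:
  "has_bochner_integral lborel (\<lambda>s::real. 1 / (pi * (1 + s\<^sup>2))) 1"
proof -
  have "integrable lborel (\<lambda>x::real. inverse (1 + x\<^sup>2))"
    using integrable_inverse_1_plus_square by (simp add: set_integrable_def einterval_def)
  moreover have "(\<integral>x. inverse (1 + (x::real)\<^sup>2) \<partial>lborel) = pi"
    using LBINT_inverse_1_plus_square
    by (simp add: interval_lebesgue_integral_def set_lebesgue_integral_def einterval_def)
  ultimately have "has_bochner_integral lborel (\<lambda>x::real. inverse (1 + x\<^sup>2)) pi"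
    by (simp add: has_bochner_integral_iff)
  from has_bochner_integral_mult_left[OF this, of "1 / pi"] show ?thesis
    by (simp add: field_simps)
qed

text \<open>The substitution t = Re z + s Im z moves the dependence on z from the kernel into the
  argument of \<open>u\<close> and leaves a fixed probability density, the Cauchy density. Limits in
  z become dominated convergence.\<close>

lemma poisson_integral_affine:
  assumes "0 < Im z" and [measurable]: "u \<in> borel_measurable borel"
  shows "(\<integral>t. u t * poisson_kernel z t \<partial>lebesgue) =
         (\<integral>s. u (Re z + Im z * s) * (1 / (pi * (1 + s\<^sup>2))) \<partial>lborel)"
proof -
  have "(\<integral>t. u t * poisson_kernel z t \<partial>lebesgue) = (\<integral>t. u t * poisson_kernel z t \<partial>lborel)"
    by (intro integral_completion) measurable
  also have "\<dots> = Im z * (\<integral>s. u (Re z + Im z * s) * poisson_kernel z (Re z + Im z * s) \<partial>lborel)"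
    using assms(1) by (subst lborel_integral_real_affine[where c="Im z" and t="Re z"]) auto
  also have "\<dots> = (\<integral>s. u (Re z + Im z * s) * (Im z * poisson_kernel z (Re z + Im z * s)) \<partial>lborel)"
    by (subst integral_mult_right_zero[symmetric]) (simp add: ac_simps)
  finally show ?thesis by (simp only: poisson_kernel_affine[OF assms(1)])
qed

lemma has_bochner_integral_poisson_kernel:
  assumes "0 < Im z"
  shows "has_bochner_integral lebesgue (poisson_kernel z) 1"
proof -
  have "has_bochner_integral lborel (\<lambda>s. Im z * poisson_kernel z (Re z + Im z * s)) 1"
    unfolding poisson_kernel_affine[OF assms] by (rule has_bochner_integral_cauchy_density)
  from has_bochner_integral_mult_right[OF this, of "1 / Im z"]
  have "has_bochner_integral lborel (\<lambda>s. poisson_kernel z (Re z + Im z * s)) (1 / Im z)"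
    using assms by simp
  then have "has_bochner_integral lborel (poisson_kernel z) 1"
    using assms lborel_has_bochner_integral_real_affine_iff[of "Im z" "poisson_kernel z" 1 "Re z"]
    by (simp add: field_simps)
  then show ?thesis
    by (simp add: has_bochner_integral_iff integrable_completion integral_completion)
qed

lemma integrable_poisson_kernel: "0 < Im z \<Longrightarrow> integrable lebesgue (poisson_kernel z)"
  and integral_poisson_kernel: "0 < Im z \<Longrightarrow> (\<integral>t. poisson_kernel z t \<partial>lebesgue) = 1"
  using has_bochner_integral_poisson_kernel by (auto simp: has_bochner_integral_iff)

lemma integrable_mult_poisson_kernel_bounded:
  fixes v :: "real \<Rightarrow> real"
  assumes "0 < Im z" and [measurable]: "v \<in> borel_measurable lebesgue" and "\<And>t. \<bar>v t\<bar> \<le> B"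
  shows "integrable lebesgue (\<lambda>t. v t * poisson_kernel z t)"
proof (rule Bochner_Integration.integrable_bound)
  show "integrable lebesgue (\<lambda>t. B * poisson_kernel z t)"
    using integrable_poisson_kernel[OF assms(1)] by simp
  have "0 \<le> B" using assms(3)[of 0] by linarith
  then show "AE t in lebesgue. norm (v t * poisson_kernel z t) \<le> norm (B * poisson_kernel z t)"
    using assms(3) by (auto simp: abs_mult intro!: mult_right_mono)
qed measurable

lemma integrable_mult_poisson_kernel:
  fixes v :: "real \<Rightarrow> real"
  assumes "0 < Im z" and [measurable]: "v \<in> borel_measurable lebesgue"
    and "integrable lebesgue (\<lambda>t. \<bar>v t\<bar> / (1 + t\<^sup>2))"
  shows "integrable lebesgue (\<lambda>t. v t * poisson_kernel z t)"
proof -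
  obtain C where C: "0 < C" "\<And>t. poisson_kernel z t \<le> C / (1 + t\<^sup>2)"
    using poisson_kernel_le[OF assms(1)] by blast
  show ?thesis
  proof (rule Bochner_Integration.integrable_bound)
    show "integrable lebesgue (\<lambda>t. C * (\<bar>v t\<bar> / (1 + t\<^sup>2)))" by (intro integrable_mult_right assms(3))
    have "\<bar>v t\<bar> * poisson_kernel z t \<le> \<bar>v t\<bar> * (C / (1 + t\<^sup>2))" for t
      using C(2) by (intro mult_left_mono) auto
    then show "AE t in lebesgue. norm (v t * poisson_kernel z t) \<le> norm (C * (\<bar>v t\<bar> / (1 + t\<^sup>2)))"
      using C(1) poisson_kernel_nonneg[of z] assms(1) by (auto simp: abs_mult ac_simps)
  qed measurable
qed

lemma integrable_abs_bounded_div_one_plus_square: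
  fixes v :: "real \<Rightarrow> real"
  assumes [measurable]: "v \<in> borel_measurable lebesgue" and "\<And>t. \<bar>v t\<bar> \<le> B"
  shows "integrable lebesgue (\<lambda>t. \<bar>v t\<bar> / (1 + t\<^sup>2))"
proof -
  have "integrable lebesgue (\<lambda>t. \<bar>v t\<bar> * poisson_kernel \<i> t)"
    using assms(2) by (intro integrable_mult_poisson_kernel_bounded) auto
  from integrable_mult_right[OF this, of pi] show ?thesis
    unfolding poisson_kernel_eq by (simp add: add.commute)
qed

section \<open>The Schwarz kernel and holomorphy of the Schwarz integral\<close>

lemma schwarz_kernel_bound:
  assumes "0 < Im \<xi>"
  shows "norm ((1 + complex_of_real t * \<xi>) / (complex_of_real t - \<xi>))
           \<le> norm \<xi> + norm (1 + \<xi>\<^sup>2) / Im \<xi>"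
proof -
  have n: "Im \<xi> \<le> norm (complex_of_real t - \<xi>)" by (rule Im_le_norm_real_diff)
  then have nz: "complex_of_real t - \<xi> \<noteq> 0" using assms by auto
  \<comment> \<open>Polynomial division in t: only the second summand depends on t, and it is
    bounded because |t - \<xi>| >= Im \<xi>.\<close>
  then have "(1 + complex_of_real t * \<xi>) / (complex_of_real t - \<xi>)
      = \<xi> + (1 + \<xi>\<^sup>2) / (complex_of_real t - \<xi>)"
    by (simp add: field_simps power2_eq_square)
  then have "norm ((1 + complex_of_real t * \<xi>) / (complex_of_real t - \<xi>))
      \<le> norm \<xi> + norm (1 + \<xi>\<^sup>2) / norm (complex_of_real t - \<xi>)"
    by (metis norm_triangle_ineq norm_divide)
  also have "norm (1 + \<xi>\<^sup>2) / norm (complex_of_real t - \<xi>) \<le> norm (1 + \<xi>\<^sup>2) / Im \<xi>"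
    using n assms nz by (intro divide_left_mono) auto
  finally show ?thesis by simp
qed

lemma integrable_mult_bounded:
  fixes w :: "'a \<Rightarrow> real" and g :: "'a \<Rightarrow> complex"
  assumes "integrable M w" and [measurable]: "g \<in> borel_measurable M"
    and "\<And>t. norm (g t) \<le> B"
  shows "integrable M (\<lambda>t. complex_of_real (w t) * g t)"
proof (rule Bochner_Integration.integrable_bound)
  show "integrable M (\<lambda>t. B * w t)" using assms(1) by simp
  have [measurable]: "w \<in> borel_measurable M" using assms(1) by simp
  show "(\<lambda>t. complex_of_real (w t) * g t) \<in> borel_measurable M" by measurable
  have "norm (complex_of_real (w t) * g t) \<le> norm (B * w t)" for t
  proof -
    have "0 \<le> B" using assms(3)[of t] norm_ge_zero[of "g t"] by linarith
    then show ?thesis using mult_right_mono[OF assms(3)[of t], of "\<bar>w t\<bar>"]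
      by (simp add: norm_mult abs_mult mult.commute)
  qed
  then show "AE t in M. norm (complex_of_real (w t) * g t) \<le> norm (B * w t)" by simp
qed

lemma borel_measurable_lebesgueI:
  fixes f :: "real \<Rightarrow> 'a::topological_space"
  shows "f \<in> borel_measurable borel \<Longrightarrow> f \<in> borel_measurable lebesgue"
  by (simp add: measurable_completion)

lemma integrable_schwarz_kernel:
  assumes "0 < Im \<xi>" "integrable lebesgue (\<lambda>t. v t / (1 + t\<^sup>2))"
  shows "integrable lebesgue (\<lambda>t. complex_of_real (v t / (1 + t\<^sup>2)) *
        ((1 + complex_of_real t * \<xi>) / (complex_of_real t - \<xi>)))"
  by (rule integrable_mult_bounded[OF assms(2) _ schwarz_kernel_bound[OF assms(1)]])
     (rule borel_measurable_lebesgueI, measurable)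

lemma Re_schwarz_integral:
  assumes "0 < Im \<xi>" "integrable lebesgue (\<lambda>t. v t / (1 + t\<^sup>2))"
  shows "Re (schwarz_integral v \<xi>) = (\<integral>t. v t * poisson_kernel \<xi> t \<partial>lebesgue)"
proof -
  let ?k = "\<lambda>t. complex_of_real (v t / (1 + t\<^sup>2)) *
        ((1 + complex_of_real t * \<xi>) / (complex_of_real t - \<xi>))"
  have "Re (1 / (\<i> * complex_of_real pi) * w) = Im w / pi" for w
    by (simp add: Re_divide Im_divide power2_eq_square)
  then have "Re (schwarz_integral v \<xi>) = Im (integral\<^sup>L lebesgue ?k) / pi"
    unfolding schwarz_integral_def by blast
  also have "\<dots> = (\<integral>t. Im (?k t) \<partial>lebesgue) / pi"
    by (subst integral_Im[OF integrable_schwarz_kernel[OF assms]]) simp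
  also have "\<dots> = (\<integral>t. Im (?k t) / pi \<partial>lebesgue)" by simp
  also have "(\<lambda>t. Im (?k t) / pi) = (\<lambda>t. v t * poisson_kernel \<xi> t)"
  proof
    fix t
    have im: "Im (complex_of_real r * c) = r * Im c" for r c by simp
    have d: "(t - Re \<xi>)\<^sup>2 + (Im \<xi>)\<^sup>2 \<noteq> 0" using assms(1) by (simp add: sum_power2_eq_zero_iff)
    have e: "1 + t\<^sup>2 \<noteq> 0" by (metis add_cancel_right_right add_nonneg_eq_0_iff zero_le_one zero_le_power2 zero_neq_one)
    \<comment> \<open>The factor 1 + t^2 in the numerator cancels the weight, which leaves the
      Poisson kernel.\<close>
    have "Im ((1 + complex_of_real t * \<xi>) / (complex_of_real t - \<xi>))
        = Im \<xi> * (1 + t\<^sup>2) / ((t - Re \<xi>)\<^sup>2 + (Im \<xi>)\<^sup>2)"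
      by (simp add: Im_divide power2_eq_square algebra_simps)
    then show "Im (?k t) / pi = v t * poisson_kernel \<xi> t"
      using d e unfolding im poisson_kernel_eq by simp
  qed
  finally show ?thesis .
qed

lemma schwarz_kernel_diff:
  assumes "t \<noteq> a" "t \<noteq> (b::'a::field)"
  shows "(1 + t * b) / (t - b) - (1 + t * a) / (t - a)
       = (b - a) * ((1 + t\<^sup>2) / ((t - b) * (t - a)))"
  using assms by (simp add: divide_simps) (simp add: algebra_simps power2_eq_square)

text \<open>Differentiation under the integral with an explicit remainder: by
  \<open>schwarz_kernel_diff\<close> the difference quotient of the kernel differs from its limit by
  b - a times a function bounded in t, uniformly for b near a. Hence the difference quotients of the
  integral converge with error O(|b - a|).\<close>

lemma holomorphic_schwarz_integral:
  assumes w: "integrable lebesgue (\<lambda>t. v t / (1 + t\<^sup>2))"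
  shows "schwarz_integral v holomorphic_on upper_half_plane"
proof -
  define w where "w = (\<lambda>t. v t / (1 + t\<^sup>2))"
  define k where "k = (\<lambda>\<xi> t. (1 + complex_of_real t * \<xi>) / (complex_of_real t - \<xi>))"
  define J where "J = (\<lambda>\<xi>. \<integral>t. complex_of_real (w t) * k \<xi> t \<partial>lebesgue)"
  have "J holomorphic_on upper_half_plane"
  proof (rule holomorphic_onI)
    fix a assume "a \<in> upper_half_plane"
    then have a: "0 < Im a" by simp
    obtain C where C: "0 < C" "\<And>t. 1 + t\<^sup>2 \<le> C * (norm (complex_of_real t - a))\<^sup>2"
      using one_plus_square_le_norm_real_diff[OF a] by blast
    \<comment> \<open>The derivative of \<open>k\<close> with respect to \<xi> at
      \<open>a\<close>.\<close>
    define q where "q = (\<lambda>t. (1 + complex_of_real t ^ 2) / (complex_of_real t - a)\<^sup>2)"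
    define D where "D = (\<integral>t. complex_of_real (w t) * q t \<partial>lebesgue)"
    have [measurable]: "q \<in> borel_measurable lebesgue"
      unfolding q_def by (rule borel_measurable_lebesgueI) measurable
    have nz: "complex_of_real t \<noteq> b" if "0 < Im b" for t b using that by auto
    have q: "norm (q t) \<le> C" for t
    proof -
      have "norm (1 + complex_of_real t ^ 2) = 1 + t\<^sup>2"
      proof -
        have "1 + complex_of_real t ^ 2 = complex_of_real (1 + t\<^sup>2)" by simp
        then show ?thesis by (metis norm_of_real abs_of_nonneg add_nonneg_nonneg zero_le_one zero_le_power2)
      qed
      then show ?thesis using C(2)[of t] nz[OF a, of t]
        by (simp add: q_def norm_divide norm_power divide_le_eq)
    qed
    have wq: "integrable lebesgue (\<lambda>t. complex_of_real (w t) * q t)"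
      using integrable_mult_bounded[of lebesgue w q C] w q by (simp add: w_def)
    have wk: "integrable lebesgue (\<lambda>t. complex_of_real (w t) * k b t)" if "0 < Im b" for b
      using integrable_schwarz_kernel[OF that w] by (simp add: w_def k_def)
    define L where "L = (\<integral>t. \<bar>w t\<bar> * (C * (2 / Im a)) \<partial>lebesgue)"
    \<comment> \<open>The radius Im a / 2 keeps b at height at least Im a / 2, so |t - b| >= Im a /
      2; this is the factor 2 / Im a in \<open>L\<close>.\<close>
    have *: "norm ((J b - J a) / (b - a) - D) \<le> L * norm (b - a)"
      if b: "b \<noteq> a" "dist b a < Im a / 2" for b
    proof -
      have "\<bar>Im b - Im a\<bar> < Im a / 2"
        using b(2) abs_Im_le_cmod[of "b - a"] by (simp add: dist_norm)
      then have Ib: "Im a / 2 < Im b" by linarith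
      then have b0: "0 < Im b" using a by linarith
      have pt: "(k b t - k a t) / (b - a) - q t = (b - a) * (q t / (complex_of_real t - b))" for t
      proof -
        have "(k b t - k a t) / (b - a)
            = (1 + (complex_of_real t)\<^sup>2) / ((complex_of_real t - b) * (complex_of_real t - a))"
          unfolding k_def using b(1)
          by (subst schwarz_kernel_diff[OF nz[OF a] nz[OF b0]]) simp
        moreover have "N / (x * y) - N / y\<^sup>2 = (y - x) * (N / y\<^sup>2 / x)" if "x \<noteq> 0" "y \<noteq> 0" for N x y :: complex
          using that by (simp add: field_simps power2_eq_square)
        from this[of "complex_of_real t - b" "complex_of_real t - a"]
        have "N / ((complex_of_real t - b) * (complex_of_real t - a)) - N / (complex_of_real t - a)\<^sup>2
          = (b - a) * (N / (complex_of_real t - a)\<^sup>2 / (complex_of_real t - b))" for N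
          using nz[OF a, of t] nz[OF b0, of t] by simp
        ultimately show ?thesis by (simp add: q_def)
      qed
      have "(J b - J a) / (b - a) - D
          = (\<integral>t. (complex_of_real (w t) * k b t - complex_of_real (w t) * k a t) / (b - a)
                 - complex_of_real (w t) * q t \<partial>lebesgue)"
        unfolding J_def D_def using wk[OF a] wk[OF b0] wq by simp
      also have "\<dots> = (\<integral>t. complex_of_real (w t) * ((k b t - k a t) / (b - a) - q t) \<partial>lebesgue)"
        by (intro Bochner_Integration.integral_cong refl) (simp add: algebra_simps diff_divide_distrib)
      also have "\<dots> = (b - a) * (\<integral>t. complex_of_real (w t) * (q t / (complex_of_real t - b)) \<partial>lebesgue)"
        unfolding pt by (subst integral_mult_right_zero[symmetric]) (simp add: ac_simps)
      finally have eq: "norm ((J b - J a) / (b - a) - D)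
          = norm (b - a) * norm (\<integral>t. complex_of_real (w t) * (q t / (complex_of_real t - b)) \<partial>lebesgue)"
        by (simp add: norm_mult)
      have "norm (\<integral>t. complex_of_real (w t) * (q t / (complex_of_real t - b)) \<partial>lebesgue) \<le> L"
        unfolding L_def
      proof (rule Bochner_Integration.integral_norm_bound_integral)
        have bd: "norm (q t / (complex_of_real t - b)) \<le> C * (2 / Im a)" for t
        proof -
          have "Im a / 2 \<le> norm (complex_of_real t - b)"
            using Im_le_norm_real_diff[of b t] Ib by linarith
          then have "norm (q t) / norm (complex_of_real t - b) \<le> C / (Im a / 2)"
            using q[of t] a C(1) by (intro frac_le) auto
          then show ?thesis by (simp add: norm_divide)
        qed
        have [measurable]: "(\<lambda>t. complex_of_real t - b) \<in> borel_measurable lebesgue"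
          by (rule borel_measurable_lebesgueI) measurable
        show "integrable lebesgue (\<lambda>t. complex_of_real (w t) * (q t / (complex_of_real t - b)))"
          by (rule integrable_mult_bounded[OF _ _ bd]) (use w w_def in auto)
        show "integrable lebesgue (\<lambda>t. \<bar>w t\<bar> * (C * (2 / Im a)))"
          using w unfolding w_def by (intro integrable_mult_left integrable_abs)
        show "norm (complex_of_real (w t) * (q t / (complex_of_real t - b))) \<le> \<bar>w t\<bar> * (C * (2 / Im a))" for t
          using bd[of t] unfolding norm_mult norm_of_real by (intro mult_left_mono) auto
      qed
      then show ?thesis unfolding eq by (metis mult.commute mult_left_mono norm_ge_zero)
    qed
    have "((\<lambda>b. (J b - J a) / (b - a) - D) \<longlongrightarrow> 0) (at a)"
    proof (rule Lim_null_comparison)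
      show "\<forall>\<^sub>F b in at a. norm ((J b - J a) / (b - a) - D) \<le> L * norm (b - a)"
        using * a by (auto simp: eventually_at intro!: exI[of _ "Im a / 2"])
      show "((\<lambda>b. L * norm (b - a)) \<longlongrightarrow> 0) (at a)"
        by (auto intro!: tendsto_eq_intros)
    qed
    then have "((\<lambda>b. (J b - J a) / (b - a)) \<longlongrightarrow> D) (at a)" by (simp add: Lim_null[symmetric])
    then have "(J has_field_derivative D) (at a)" by (simp add: has_field_derivative_iff)
    then show "J field_differentiable at a within upper_half_plane"
      using field_differentiable_def field_differentiable_at_within by blast
  qed
  then have "(\<lambda>\<xi>. 1 / (\<i> * complex_of_real pi) * J \<xi>) holomorphic_on upper_half_plane"
    by (intro holomorphic_intros)
  then show ?thesis
    unfolding J_def k_def w_def schwarz_integral_def[abs_def] .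
qed

section \<open>A maximum principle on the upper half-plane\<close>

text \<open>If |g z| > c > 1, the set where |g| >= c is compact: decay at infinity bounds it and the
  boundary condition keeps it off the real line. So |g| attains its maximum over the half-plane, g
  is constant, and a nonzero constant contradicts the decay.\<close>

lemma norm_le_1_upper_half_plane_vanishing:
  assumes hol: "g holomorphic_on upper_half_plane"
    and inf: "\<And>e. 0 < e \<Longrightarrow> \<exists>R. \<forall>z. 0 < Im z \<longrightarrow> R \<le> norm z \<longrightarrow> norm (g z) < e"
    and bnd: "\<And>x e. 0 < e \<Longrightarrow>
       \<forall>\<^sub>F z in at (complex_of_real x) within upper_half_plane. norm (g z) < 1 + e"
    and z: "0 < Im z"
  shows "norm (g z) \<le> 1"
proof (rule ccontr)
  assume "\<not> norm (g z) \<le> 1"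
  then have gz: "1 < norm (g z)" by simp
  have cont: "continuous_on upper_half_plane g"
    using hol holomorphic_on_imp_continuous_on by blast
  define c where "c = (1 + norm (g z)) / 2"
  have c: "1 < c" "c < norm (g z)" using gz by (auto simp: c_def)
  define S where "S = {w. 0 < Im w \<and> c \<le> norm (g w)}"
  have zS: "z \<in> S" using z c by (simp add: S_def)
  obtain R where R: "\<And>w. 0 < Im w \<Longrightarrow> R \<le> norm w \<Longrightarrow> norm (g w) < c"
    using inf[of c] c by auto
  have "bounded S"
    unfolding bounded_iff using R by (intro exI[of _ R]) (force simp: S_def)
  moreover have "closed S"
    unfolding closed_sequential_limits
  proof (intro allI impI, elim conjE)
    fix X l assume X: "\<forall>n. X n \<in> S" and l: "X \<longlonglongrightarrow> l"
    have "0 \<le> Im l"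
      using X by (intro LIMSEQ_le_const[OF tendsto_Im[OF l]]) (auto simp: S_def intro: less_imp_le)
    \<comment> \<open>A sequence in \<open>S\<close> converging to a real point would eventually
      enter the region near that point where |g| < c; the boundary condition is used with e = c -
      1.\<close>
    moreover have "Im l \<noteq> 0"
    proof
      assume "Im l = 0"
      then have lr: "complex_of_real (Re l) = l" by (simp add: complex_eq_iff)
      have "filterlim X (at l within upper_half_plane) sequentially"
        unfolding filterlim_at
      proof (intro conjI always_eventually allI l)
        fix n
        have "0 < Im (X n)" using X by (auto simp: S_def)
        then show "X n \<in> upper_half_plane" "X n \<noteq> l" using \<open>Im l = 0\<close> by auto
      qed
      moreover have "\<forall>\<^sub>F w in at l within upper_half_plane. norm (g w) < c"
        using bnd[of "c - 1" "Re l"] c lr by simp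
      ultimately have "\<forall>\<^sub>F n in sequentially. norm (g (X n)) < c"
        by (rule eventually_compose_filterlim[rotated])
      then obtain n where "norm (g (X n)) < c"
        using eventually_happens'[OF sequentially_bot] by blast
      then show False using spec[OF X, of n] by (simp add: S_def)
    qed
    ultimately have Il: "0 < Im l" by simp
    then have "isCont g l"
      using cont Il continuous_on_eq_continuous_at[OF open_upper_half_plane, of g] by simp
    then have "(\<lambda>n. norm (g (X n))) \<longlonglongrightarrow> norm (g l)"
      by (intro tendsto_norm isCont_tendsto_compose[OF _ l])
    then have "c \<le> norm (g l)"
      using X by (intro LIMSEQ_le_const) (auto simp: S_def)
    with Il show "l \<in> S" by (simp add: S_def)
  qed
  ultimately have "compact S" by (simp add: compact_eq_bounded_closed)
  moreover have "continuous_on S (\<lambda>w. norm (g w))"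
    by (intro continuous_on_norm continuous_on_subset[OF cont]) (auto simp: S_def)
  ultimately obtain m where m: "m \<in> S" "\<And>w. w \<in> S \<Longrightarrow> norm (g w) \<le> norm (g m)"
    using continuous_attains_sup[of S "\<lambda>w. norm (g w)"] zS by auto
  have max: "norm (g w) \<le> norm (g m)" if "w \<in> upper_half_plane" for w
    using m(2)[of w] m(1) that by (cases "w \<in> S") (auto simp: S_def)
  have "g constant_on upper_half_plane"
    by (rule maximum_modulus_principle[OF hol open_upper_half_plane _ open_upper_half_plane order_refl _ max])
       (use m in \<open>auto simp: S_def convex_connected convex_upper_half_plane\<close>)
  then obtain k where k: "\<And>w. 0 < Im w \<Longrightarrow> g w = k" by (auto simp: constant_on_def)
  have "norm (g (\<i> * of_real (\<bar>R\<bar> + 1))) < c"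
    by (rule R) (auto simp: norm_mult simp del: of_real_add)
  moreover have "g (\<i> * of_real (\<bar>R\<bar> + 1)) = g z" using k z by simp
  ultimately show False using c by simp
qed

text \<open>Dividing by \<open>1 - \<i>\<delta>z\<close>, which has modulus at least 1, forces decay at infinity.\<close>

lemma norm_le_1_upper_half_plane:
  assumes hol: "f holomorphic_on upper_half_plane"
    and bdd: "\<And>z. 0 < Im z \<Longrightarrow> norm (f z) \<le> B"
    and bnd: "\<And>x e. 0 < e \<Longrightarrow>
       \<forall>\<^sub>F z in at (complex_of_real x) within upper_half_plane. norm (f z) < 1 + e"
    and z: "0 < Im z"
  shows "norm (f z) \<le> 1"
proof -
  have B: "0 \<le> B" using bdd[OF z] norm_ge_zero[of "f z"] by linarith
  have main: "norm (f z) \<le> norm (1 - \<i> * of_real d * z)" if d: "0 < d" for d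
  proof -
    define q where "q w = 1 - \<i> * complex_of_real d * w" for w
    have q1: "1 \<le> norm (q w)" if "0 < Im w" for w
    proof -
      have "1 \<le> 1 + d * Im w" using d that by simp
      also have "\<dots> = Re (q w)" by (simp add: q_def)
      also have "\<dots> \<le> norm (q w)" by (rule complex_Re_le_cmod)
      finally show ?thesis .
    qed
    have q2: "d * norm w - 1 \<le> norm (q w)" for w
      using norm_triangle_ineq2[of "\<i> * complex_of_real d * w" 1] d
      by (simp add: q_def norm_mult norm_minus_commute)
    have "norm (f z / q z) \<le> 1"
    proof (rule norm_le_1_upper_half_plane_vanishing[where g = "\<lambda>w. f w / q w", OF _ _ _ z])
      have nz: "q w \<noteq> 0" if "0 < Im w" for w using q1[OF that] by auto
      have "q holomorphic_on upper_half_plane" unfolding q_def by (intro holomorphic_intros)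
      then show "(\<lambda>w. f w / q w) holomorphic_on upper_half_plane"
        using hol nz by (intro holomorphic_intros) auto
    next
      fix e :: real assume e: "0 < e"
      show "\<exists>R. \<forall>w. 0 < Im w \<longrightarrow> R \<le> norm w \<longrightarrow> norm (f w / q w) < e"
      proof (intro exI allI impI)
        \<comment> \<open>The radius comes from |q w| >= d |w| - 1: it makes |q w| at least B/e + 1,
          hence the quotient smaller than e.\<close>
        fix w assume w: "0 < Im w" "(B / e + 2) / d \<le> norm w"
        have "B / e + 2 \<le> d * norm w" using w(2) d by (simp add: field_simps)
        with q2[of w] have "B / e < norm (q w)" by linarith
        then have "B < e * norm (q w)" using e by (simp add: field_simps)
        then show "norm (f w / q w) < e"
          using bdd[OF w(1)] q1[OF w(1)] e by (simp add: norm_divide divide_less_eq)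
      qed
    next
      fix x e :: real assume e: "0 < e"
      have H: "\<forall>\<^sub>F w in at (complex_of_real x) within upper_half_plane. 0 < Im w"
        by (simp add: eventually_at_filter)
      show "\<forall>\<^sub>F w in at (complex_of_real x) within upper_half_plane. norm (f w / q w) < 1 + e"
        using bnd[OF e, of x] H
      proof eventually_elim
        case (elim w)
        have "norm (f w / q w) \<le> norm (f w)"
          using q1[OF elim(2)] by (simp add: norm_divide divide_le_eq mult_left_le mult_le_cancel_left1)
        then show ?case using elim(1) by linarith
      qed
    qed
    moreover have "0 < norm (q z)" using q1[OF z] by linarith
    ultimately have "norm (f z) \<le> norm (q z)" by (simp add: norm_divide pos_divide_le_eq)
    then show ?thesis by (simp add: q_def)
  qed
  \<comment> \<open>The left-hand side of \<open>main\<close> does not depend on d, while its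
    right-hand side tends to 1 as d decreases to 0.\<close>
  have "((\<lambda>d. norm (1 - \<i> * of_real d * z)) \<longlongrightarrow> norm (1 - \<i> * of_real 0 * z)) (at_right (0::real))"
    by (intro tendsto_intros)
  then have "norm (f z) \<le> norm (1 - \<i> * of_real 0 * z)"
    by (rule tendsto_lowerbound) (auto simp: eventually_at_right_less main intro: eventually_at_right_less[THEN eventually_mono])
  then show ?thesis by simp
qed

section \<open>Boundary limits of Poisson integrals and the bound for bounded functions\<close>

lemma abs_poisson_integral_le:
  assumes z: "0 < Im z" and [measurable]: "u \<in> borel_measurable lebesgue"
    and u: "\<And>t. \<bar>u t\<bar> \<le> B"
  shows "\<bar>\<integral>t. u t * poisson_kernel z t \<partial>lebesgue\<bar> \<le> B"
proof -
  have "norm (\<integral>t. u t * poisson_kernel z t \<partial>lebesgue) \<le> (\<integral>t. B * poisson_kernel z t \<partial>lebesgue)"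
  proof (rule Bochner_Integration.integral_norm_bound_integral)
    show "integrable lebesgue (\<lambda>t. u t * poisson_kernel z t)"
      using z u by (intro integrable_mult_poisson_kernel_bounded) auto
    show "norm (u t * poisson_kernel z t) \<le> B * poisson_kernel z t" for t
      using u[of t] z poisson_kernel_nonneg[of z t] by (simp add: abs_mult mult_right_mono)
  qed (use z integrable_poisson_kernel in simp)
  then show ?thesis using integral_poisson_kernel[OF z] by simp
qed

text \<open>In the form of \<open>poisson_integral_affine\<close> the integrands tend to
  \<open>u x\<close> times the Cauchy density and are dominated by \<open>B\<close> times it.
  Continuity of \<open>u\<close> yields an unrestricted limit, not merely a non-tangential one, as
  the boundary condition of the maximum principle demands.\<close>

lemma tendsto_poisson_integral:
  fixes u :: "real \<Rightarrow> real"
  assumes cont: "continuous_on UNIV u" and u: "\<And>t. \<bar>u t\<bar> \<le> B"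
  shows "((\<lambda>z. \<integral>t. u t * poisson_kernel z t \<partial>lebesgue) \<longlongrightarrow> u x)
           (at (complex_of_real x) within upper_half_plane)"
  unfolding tendsto_at_iff_sequentially
proof (intro allI impI)
  fix X assume X: "\<forall>i. X i \<in> upper_half_plane - {complex_of_real x}" and lim: "X \<longlonglongrightarrow> complex_of_real x"
  have [measurable]: "u \<in> borel_measurable borel"
    using cont by (rule borel_measurable_continuous_onI)
  have "(\<lambda>i. \<integral>s. u (Re (X i) + Im (X i) * s) * (1 / (pi * (1 + s\<^sup>2))) \<partial>lborel)
      \<longlonglongrightarrow> (\<integral>s. u x * (1 / (pi * (1 + s\<^sup>2))) \<partial>lborel)"
  proof (rule integral_dominated_convergence)
    show "integrable lborel (\<lambda>s. B * (1 / (pi * (1 + s\<^sup>2))))"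
      using has_bochner_integral_cauchy_density by (intro integrable_mult_right) (simp add: has_bochner_integral_iff)
    show "AE s in lborel. (\<lambda>i. u (Re (X i) + Im (X i) * s) * (1 / (pi * (1 + s\<^sup>2))))
        \<longlonglongrightarrow> u x * (1 / (pi * (1 + s\<^sup>2)))"
    proof (intro AE_I2 tendsto_mult tendsto_const)
      fix s
      have "(\<lambda>i. Re (X i) + Im (X i) * s) \<longlonglongrightarrow> Re (complex_of_real x) + Im (complex_of_real x) * s"
        using lim by (intro tendsto_intros)
      then have "(\<lambda>i. Re (X i) + Im (X i) * s) \<longlonglongrightarrow> x" by simp
      moreover have "isCont u x" using cont by (simp add: continuous_on_eq_continuous_at)
      ultimately show "(\<lambda>i. u (Re (X i) + Im (X i) * s)) \<longlonglongrightarrow> u x"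
        by (rule isCont_tendsto_compose[rotated])
    qed
    show "AE s in lborel. norm (u (Re (X i) + Im (X i) * s) * (1 / (pi * (1 + s\<^sup>2))))
        \<le> B * (1 / (pi * (1 + s\<^sup>2)))" for i
      using u by (auto simp: abs_mult intro!: AE_I2 divide_right_mono)
  qed measurable
  moreover have "(\<integral>s. u x * (1 / (pi * (1 + s\<^sup>2))) \<partial>lborel) = u x"
    using has_bochner_integral_mult_right[OF has_bochner_integral_cauchy_density, of "u x"]
    by (metis has_bochner_integral_iff mult.right_neutral)
  moreover have "(\<integral>t. u t * poisson_kernel (X i) t \<partial>lebesgue)
      = (\<integral>s. u (Re (X i) + Im (X i) * s) * (1 / (pi * (1 + s\<^sup>2))) \<partial>lborel)" for i
    using X by (intro poisson_integral_affine) auto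
  ultimately show "((\<lambda>z. \<integral>t. u t * poisson_kernel z t \<partial>lebesgue) \<circ> X) \<longlonglongrightarrow> u x"
    by (simp add: comp_def)
qed

text \<open>The right-hand side is the modulus of an outer function, by which \<open>F\<close> is divided.\<close>

lemma norm_le_exp_poisson_integral_bounded:
  assumes hol: "F holomorphic_on upper_half_plane"
    and cont: "continuous_on {z. 0 \<le> Im z} F"
    and bdd: "\<And>z. 0 \<le> Im z \<Longrightarrow> norm (F z) \<le> L"
    and e: "0 < e" and z: "0 < Im z"
  shows "norm (F z) \<le> exp (\<integral>t. ln (max (norm (F (complex_of_real t))) e) * poisson_kernel z t \<partial>lebesgue)"
proof -
  \<comment> \<open>The floor \<open>e\<close> bounds the logarithm from below at zeros of
    \<open>F\<close>; the bound \<open>L\<close> does so from above. Thus \<open>u\<close> is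
    bounded and continuous.\<close>
  define u where "u t = ln (max (norm (F (complex_of_real t))) e)" for t
  define P where "P w = (\<integral>t. u t * poisson_kernel w t \<partial>lebesgue)" for w
  define D where "D = \<bar>ln e\<bar> + \<bar>ln (max L e)\<bar>"
  have L: "0 \<le> L" using order_trans[OF norm_ge_zero bdd[of 0]] by simp
  have cF: "continuous_on UNIV (\<lambda>t. F (complex_of_real t))"
    by (rule continuous_on_compose2[OF cont]) (auto intro: continuous_intros)
  have cu: "continuous_on UNIV u"
    unfolding u_def using e by (intro continuous_intros cF) (auto simp: max_def)
  have [measurable]: "u \<in> borel_measurable lebesgue"
    using borel_measurable_continuous_onI[OF cu] by (rule borel_measurable_lebesgueI)
  have u: "\<bar>u t\<bar> \<le> D" for t
  proof -
    have "ln e \<le> u t" unfolding u_def using e by simp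
    moreover have "u t \<le> ln (max L e)"
      unfolding u_def using e bdd[of "complex_of_real t"] by (subst ln_le_cancel_iff) auto
    ultimately show ?thesis by (auto simp: D_def)
  qed
  have iu: "integrable lebesgue (\<lambda>t. u t / (1 + t\<^sup>2))"
  proof (rule Bochner_Integration.integrable_bound)
    show "integrable lebesgue (\<lambda>t. \<bar>u t\<bar> / (1 + t\<^sup>2))"
      by (rule integrable_abs_bounded_div_one_plus_square[OF _ u]) measurable
    have "(\<lambda>t. u t / (1 + t\<^sup>2)) \<in> borel_measurable borel"
      using borel_measurable_continuous_onI[OF cu] by measurable
    then show "(\<lambda>t. u t / (1 + t\<^sup>2)) \<in> borel_measurable lebesgue"
      by (rule borel_measurable_lebesgueI)
  qed simp
  define U where "U w = exp (schwarz_integral u w)" for w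
  have U: "norm (U w) = exp (P w)" if "0 < Im w" for w
    using Re_schwarz_integral[OF that iu] by (simp add: U_def P_def norm_exp_eq_Re)
  have P: "\<bar>P w\<bar> \<le> D" if "0 < Im w" for w
    unfolding P_def by (rule abs_poisson_integral_le[OF that _ u]) measurable
  have "norm (F z / U z) \<le> 1"
  proof (rule norm_le_1_upper_half_plane[where f = "\<lambda>w. F w / U w", OF _ _ _ z])
    show "(\<lambda>w. F w / U w) holomorphic_on upper_half_plane"
      unfolding U_def by (intro holomorphic_intros hol holomorphic_schwarz_integral iu) auto
    show "norm (F w / U w) \<le> L * exp D" if "0 < Im w" for w
    proof -
      have "norm (F w / U w) = norm (F w) * exp (- P w)"
        using U[OF that] by (simp add: norm_divide exp_minus field_simps)
      also have "\<dots> \<le> L * exp D"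
        using bdd[of w] P[OF that] that L by (intro mult_mono) auto
      finally show ?thesis .
    qed
    \<comment> \<open>At a real point x the modulus of the quotient tends to |F x| / max |F x| e,
      which is at most 1.\<close>
    fix x e' :: real assume e': "0 < e'"
    have "(F \<longlongrightarrow> F (complex_of_real x)) (at (complex_of_real x) within {z. 0 \<le> Im z})"
      using cont by (simp add: continuous_on_def)
    then have "(F \<longlongrightarrow> F (complex_of_real x)) (at (complex_of_real x) within upper_half_plane)"
      by (rule tendsto_within_subset) (auto simp: upper_half_plane_def)
    moreover have "(P \<longlongrightarrow> u x) (at (complex_of_real x) within upper_half_plane)"
      unfolding P_def by (rule tendsto_poisson_integral[OF cu u])
    ultimately have "((\<lambda>w. norm (F w) / exp (P w)) \<longlongrightarrow> norm (F (complex_of_real x)) / exp (u x))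
        (at (complex_of_real x) within upper_half_plane)"
      by (intro tendsto_intros) auto
    moreover have "norm (F (complex_of_real x)) / exp (u x) < 1 + e'"
    proof -
      have "exp (u x) = max (norm (F (complex_of_real x))) e" using e by (simp add: u_def)
      then have "norm (F (complex_of_real x)) / exp (u x) \<le> 1" using e by (simp add: divide_le_eq)
      then show ?thesis using e' by linarith
    qed
    ultimately have "\<forall>\<^sub>F w in at (complex_of_real x) within upper_half_plane. norm (F w) / exp (P w) < 1 + e'"
      by (rule order_tendstoD)
    moreover have "\<forall>\<^sub>F w in at (complex_of_real x) within upper_half_plane. 0 < Im w"
      by (simp add: eventually_at_filter)
    ultimately show "\<forall>\<^sub>F w in at (complex_of_real x) within upper_half_plane. norm (F w / U w) < 1 + e'"
      by eventually_elim (simp add: norm_divide U)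
  qed
  then show ?thesis
    using U[OF z] by (simp add: norm_divide divide_le_eq P_def u_def)
qed

section \<open>Hardy space functions are bounded away from the real line\<close>

lemma Hardy_mean_bound:
  assumes "F \<in> Hardy p"
  obtains M where "0 \<le> M"
    "\<And>y. 0 < y \<Longrightarrow> (\<integral>\<^sup>+x. ennreal (norm (F (Complex x y)) powr p) \<partial>lebesgue) \<le> ennreal M"
proof
  let ?S = "SUP y\<in>{0<..}. \<integral>\<^sup>+x. ennreal (norm (F (Complex x y)) powr p) \<partial>lebesgue"
  have fin: "?S < \<infinity>" using assms by (simp add: Hardy_def)
  show "0 \<le> enn2real ?S" by simp
  fix y :: real assume "0 < y"
  then have "(\<integral>\<^sup>+x. ennreal (norm (F (Complex x y)) powr p) \<partial>lebesgue) \<le> ?S"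
    by (intro SUP_upper) simp
  then show "(\<integral>\<^sup>+x. ennreal (norm (F (Complex x y)) powr p) \<partial>lebesgue) \<le> ennreal (enn2real ?S)"
    using fin by (simp add: less_top)
qed

text \<open>Takes the place of Hoelder's inequality: on an interval of length at most 1 it bounds
  the mean of |F| by 1 plus the integral of |F|^p.\<close>

lemma le_one_plus_powr:
  fixes x :: real
  assumes "0 \<le> x" "1 \<le> p"
  shows "x \<le> 1 + x powr p"
proof (cases "x \<le> 1")
  case False
  then have "x powr 1 \<le> x powr p" using assms by (intro powr_mono) auto
  then show ?thesis using False by simp
qed (simp add: add_increasing2)

lemma has_integral_horizontal_line:
  assumes d: "\<And>w. 0 < Im w \<Longrightarrow> (\<Phi> has_field_derivative F w) (at w)"
    and y: "0 < y" and ab: "a \<le> b"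
  shows "((\<lambda>t. F (Complex t y)) has_integral (\<Phi> (Complex b y) - \<Phi> (Complex a y))) {a..b}"
proof (rule fundamental_theorem_of_calculus[OF ab])
  fix t
  have "((\<lambda>t. complex_of_real t + \<i> * complex_of_real y) has_vector_derivative 1) (at t within {a..b})"
    by (auto intro!: derivative_eq_intros)
  then have "((\<lambda>t. Complex t y) has_vector_derivative 1) (at t within {a..b})"
    by (simp add: Complex_eq)
  from field_vector_diff_chain_within[OF this, of \<Phi> "F (Complex t y)"]
  show "((\<lambda>t. \<Phi> (Complex t y)) has_vector_derivative F (Complex t y)) (at t within {a..b})"
    using d[of "Complex t y"] y by (simp add: comp_def has_field_derivative_at_within)
qed

text \<open>A primitive has bounded unit horizontal increments; by Cauchy's estimate the horizontal
  increments of \<open>F\<close> are bounded, and so is \<open>F\<close>, being bounded in the mean.\<close>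

lemma Hardy_bounded:
  assumes F: "F \<in> Hardy p" and p: "1 \<le> p" and e: "0 < e"
  obtains L where "\<And>z. e \<le> Im z \<Longrightarrow> norm (F z) \<le> L"
proof -
  have hol: "F holomorphic_on upper_half_plane" using F by (simp add: Hardy_def)
  then have cont: "continuous_on upper_half_plane F" by (rule holomorphic_on_imp_continuous_on)
  obtain M where M: "0 \<le> M"
    "\<And>y. 0 < y \<Longrightarrow> (\<integral>\<^sup>+x. ennreal (norm (F (Complex x y)) powr p) \<partial>lebesgue) \<le> ennreal M"
    using Hardy_mean_bound[OF F] by blast
  obtain \<Phi> where \<Phi>': "\<And>w. w \<in> upper_half_plane \<Longrightarrow> (\<Phi> has_field_derivative F w) (at w within upper_half_plane)"
    using holomorphic_convex_primitive'[OF convex_upper_half_plane open_upper_half_plane hol] by blast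
  have \<Phi>: "(\<Phi> has_field_derivative F w) (at w)" if "0 < Im w" for w
    using \<Phi>'[of w] that at_within_open[OF _ open_upper_half_plane, of w] by simp
  \<comment> \<open>The bound is independent of the height y, which is what allows the increments to
    be estimated on a whole disc below.\<close>
  have incr: "norm (\<Phi> (Complex b y) - \<Phi> (Complex a y)) \<le> 1 + M"
    if y: "0 < y" and ab: "a \<le> b" "b \<le> a + 1" for a b y
  proof -
    define h where "h t = norm (F (Complex t y)) powr p" for t
    have cl: "continuous_on {a..b} (\<lambda>t. F (Complex t y))"
      by (rule continuous_on_compose2[OF cont]) (use y in \<open>auto simp: Complex_eq intro!: continuous_intros\<close>)
    have "continuous_on {a..b} h"
      unfolding h_def using p by (intro continuous_on_powr' continuous_intros cl) auto
    then have "h integrable_on {a..b}" by (rule integrable_continuous_interval)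
    then obtain I where I: "(h has_integral I) {a..b}" by blast
    have "ennreal I = (\<integral>\<^sup>+t. ennreal (indicator {a..b} t * h t) \<partial>lborel)"
      using nn_integral_has_integral_lebesgue[OF _ I] by (simp add: h_def)
    also have "\<dots> \<le> (\<integral>\<^sup>+t. ennreal (h t) \<partial>lborel)"
      by (intro nn_integral_mono ennreal_leI) (simp add: h_def indicator_def)
    also have "\<dots> \<le> ennreal M"
      using M(2)[OF y] by (simp add: h_def nn_integral_completion)
    finally have IM: "I \<le> M" using M(1) by simp
    have hF: "((\<lambda>t. F (Complex t y)) has_integral (\<Phi> (Complex b y) - \<Phi> (Complex a y))) {a..b}"
      by (rule has_integral_horizontal_line[OF \<Phi> y ab(1)])
    have h1: "((\<lambda>t. 1 + h t) has_integral ((b - a) + I)) {a..b}"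
      using has_integral_add[OF has_integral_const_real[of "1::real" a b] I] ab by simp
    have "norm (integral {a..b} (\<lambda>t. F (Complex t y))) \<le> integral {a..b} (\<lambda>t. 1 + h t)"
      using hF h1 p by (intro integral_norm_bound_integral) (auto simp: h_def le_one_plus_powr)
    then have "norm (\<Phi> (Complex b y) - \<Phi> (Complex a y)) \<le> (b - a) + I"
      using integral_unique[OF hF] integral_unique[OF h1] by simp
    then show ?thesis using IM ab by linarith
  qed
  show thesis
  proof
    fix z assume z: "e \<le> Im z"
    then have z0: "0 < Im z" using e by linarith
    have zC: "Complex (Re z) (Im z) = z" by simp
    have d: "norm (F (Complex (Re z + s) (Im z)) - F z) \<le> (1 + M) / (e / 2)" if s: "s \<in> {0..1}" for s
    proof -
      \<comment> \<open>The derivative of \<open>D\<close> is the horizontal increment of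
        \<open>F\<close>. The disc of radius e/2 about z stays in the half-plane, and there
        \<open>incr\<close> bounds \<open>D\<close> by 1 + M; Cauchy's estimate then gives (1 + M) /
        (e/2).\<close>
      define D where "D w = \<Phi> (w + of_real s) - \<Phi> w" for w
      have dD: "(D has_field_derivative (F (w + of_real s) - F w)) (at w)" if "0 < Im w" for w
        unfolding D_def using \<Phi>[of w] \<Phi>[of "w + of_real s"] that
        by (intro DERIV_diff) (simp_all add: DERIV_shift)
      have sub: "0 < Im w" if "w \<in> cball z (e / 2)" for w
        using that abs_Im_le_cmod[of "z - w"] z e by (auto simp: dist_norm)
      have "norm ((deriv ^^ 1) D z) \<le> fact 1 * (1 + M) / (e / 2) ^ 1"
      proof (rule Cauchy_inequality)
        show "D holomorphic_on ball z (e / 2)"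
          using dD sub by (intro holomorphic_onI) (metis ball_subset_cball field_differentiable_at_within field_differentiable_def subsetD)
        show "continuous_on (cball z (e / 2)) D"
          using dD sub by (intro continuous_at_imp_continuous_on) (metis DERIV_isCont)
        show "0 < e / 2" using e by simp
        fix w assume "norm (z - w) = e / 2"
        then have "0 < Im w" using sub[of w] by (simp add: dist_norm)
        moreover have "w + of_real s = Complex (Re w + s) (Im w)" by (simp add: complex_eq_iff)
        ultimately show "norm (D w) \<le> 1 + M"
          using incr[of "Im w" "Re w" "Re w + s"] s by (simp add: D_def)
      qed
      moreover have "deriv D z = F (z + of_real s) - F z" using dD[OF z0] by (rule DERIV_imp_deriv)
      moreover have "z + of_real s = Complex (Re z + s) (Im z)" by (simp add: complex_eq_iff)
      ultimately show ?thesis by simp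
    qed
    \<comment> \<open>The average of \<open>F\<close> over the unit segment starting at z is an
      increment of \<Phi>, bounded by \<open>incr\<close>; by \<open>d\<close> it differs from
      \<open>F z\<close> by at most (1 + M) / (e/2).\<close>
    have "((\<lambda>s. F (Complex s (Im z)) - F z) has_integral
        (\<Phi> (Complex (Re z + 1) (Im z)) - \<Phi> z - F z)) {Re z..Re z + 1}"
      using has_integral_diff[OF has_integral_horizontal_line[of \<Phi> F "Im z" "Re z" "Re z + 1", OF \<Phi> z0]
         has_integral_const_real[of "F z" "Re z" "Re z + 1"]] zC by simp
    moreover have "norm (F (Complex s (Im z)) - F z) \<le> (1 + M) / (e / 2)" if "s \<in> cbox (Re z) (Re z + 1)" for s
      using d[of "s - Re z"] that by simp
    ultimately have "norm (\<Phi> (Complex (Re z + 1) (Im z)) - \<Phi> z - F z)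
        \<le> (1 + M) / (e / 2) * Henstock_Kurzweil_Integration.content (cbox (Re z) (Re z + 1))"
      using M(1) e by (intro has_integral_bound) auto
    moreover have "norm (\<Phi> (Complex (Re z + 1) (Im z)) - \<Phi> z) \<le> 1 + M"
      using incr[OF z0, of "Re z" "Re z + 1"] by simp
    ultimately show "norm (F z) \<le> 1 + M + (1 + M) / (e / 2)"
      using norm_triangle_sub[of "F z" "\<Phi> (Complex (Re z + 1) (Im z)) - \<Phi> z"]
      by (simp add: norm_minus_commute)
  qed
qed

section \<open>Outer majorants\<close>

lemma
  fixes f :: "real \<Rightarrow> real"
  assumes z: "0 < Im z" and f: "integrable lebesgue f" and nn: "\<And>t. 0 \<le> f t"
  shows integrable_mult_poisson_kernel_nonneg: "integrable lebesgue (\<lambda>t. f t * poisson_kernel z t)"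
    and poisson_integral_le_integral:
      "(\<integral>t. f t * poisson_kernel z t \<partial>lebesgue) \<le> (\<integral>t. f t \<partial>lebesgue) / (pi * Im z)"
proof -
  have [measurable]: "f \<in> borel_measurable lebesgue" using f by simp
  have le: "f t * poisson_kernel z t \<le> f t * (1 / (pi * Im z))" for t
    using nn poisson_kernel_le_const[OF z] by (intro mult_left_mono) auto
  have int: "integrable lebesgue (\<lambda>t. f t * (1 / (pi * Im z)))"
    using f by (intro integrable_mult_left)
  show *: "integrable lebesgue (\<lambda>t. f t * poisson_kernel z t)"
  proof (rule Bochner_Integration.integrable_bound[OF int])
    show "AE t in lebesgue. norm (f t * poisson_kernel z t) \<le> norm (f t * (1 / (pi * Im z)))"
      using le nn poisson_kernel_nonneg[of z] z by (intro AE_I2) (simp add: abs_mult)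
  qed measurable
  show "(\<integral>t. f t * poisson_kernel z t \<partial>lebesgue) \<le> (\<integral>t. f t \<partial>lebesgue) / (pi * Im z)"
    using integral_mono[OF * int le] by simp
qed

text \<open>Truncating the argument rather than the logarithm gives the value -ln A at 0 (for A >=
  1), where the convention ln 0 = 0 would destroy monotonicity and continuity.\<close>

definition clamp_log :: "real \<Rightarrow> real \<Rightarrow> real" where
  "clamp_log A x = ln (max (1 / A) (min x A))"

lemma clamp_log_bounds:
  assumes "1 \<le> A"
  shows "\<bar>clamp_log A x\<bar> \<le> ln A"
proof -
  have m: "1 / A \<le> max (1 / A) (min x A)" "max (1 / A) (min x A) \<le> A" "0 < 1 / A"
    using assms mult_mono[of 1 A 1 A] by (auto simp: divide_le_eq)
  then have "ln (1 / A) \<le> clamp_log A x" "clamp_log A x \<le> ln A"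
    unfolding clamp_log_def using assms by (subst ln_le_cancel_iff; linarith)+
  then show ?thesis using assms by (simp add: ln_div)
qed

lemma clamp_log_mono:
  assumes "1 \<le> A" "x \<le> y"
  shows "clamp_log A x \<le> clamp_log A y"
proof -
  have "0 < max (1 / A) w" for w using assms by (simp add: less_max_iff_disj)
  moreover have "max (1 / A) (min x A) \<le> max (1 / A) (min y A)"
    using assms(2) by (intro max.mono min.mono) auto
  ultimately show ?thesis unfolding clamp_log_def by (subst ln_le_cancel_iff)
qed

text \<open>Truncation to an interval around 0 decreases absolute values. This provides the majorant
  |ln u| when A tends to infinity.\<close>

lemma abs_clamp_log_le_abs_ln:
  assumes "1 \<le> A" "0 < x"
  shows "\<bar>clamp_log A x\<bar> \<le> \<bar>ln x\<bar>"
proof -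
  have A: "0 < 1 / A" "1 / A \<le> 1" using assms by simp_all
  consider "x \<le> 1 / A" | "1 / A \<le> x" "x \<le> A" | "A \<le> x" by linarith
  then show ?thesis
  proof cases
    case 1
    then have "clamp_log A x = ln (1 / A)" using A assms unfolding clamp_log_def
      by (auto simp: max_def min_def)
    moreover have "ln x \<le> ln (1 / A)" "ln (1 / A) \<le> 0" using 1 A assms by auto
    ultimately show ?thesis by linarith
  next
    case 2
    then show ?thesis by (simp add: clamp_log_def)
  next
    case 3
    moreover have "1 / A \<le> A" using A assms by linarith
    ultimately have "clamp_log A x = ln A" unfolding clamp_log_def by (simp add: max_absorb2 min_absorb2)
    moreover have "ln A \<le> ln x" "0 \<le> ln A" using 3 assms by auto
    ultimately show ?thesis by linarith
  qed
qed

text \<open>The two sides differ in their logarithms only for x > A, by ln (x/A). Applying ln s <= s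
  to s = (x/A)^r bounds this excess by (x/A)^r / r, whose integral is controlled by the means of
  order r.\<close>

lemma ln_max_le_clamp_log:
  assumes "1 \<le> A" "0 \<le> x" "0 < r"
  shows "ln (max x (1 / A)) \<le> clamp_log A x + x powr r / (r * A powr r)"
proof (cases "x \<le> A")
  case True
  then have "clamp_log A x = ln (max x (1 / A))"
    by (simp add: clamp_log_def max.commute)
  then show ?thesis using assms by simp
next
  case False
  have A: "1 / A \<le> 1" "0 < A" using assms by simp_all
  then have "1 / A \<le> A" "1 / A \<le> x" using False assms(1) by linarith+
  then have c: "clamp_log A x = ln A" and m: "max x (1 / A) = x"
    using False by (auto simp: clamp_log_def)
  have x0: "0 < x" using False A by linarith
  have "r * ln (x / A) = ln ((x / A) powr r)" using x0 A by (simp add: ln_powr)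
  also have "\<dots> \<le> (x / A) powr r" using x0 A by (intro less_imp_le[OF ln_less_self]) simp
  also have "\<dots> = x powr r / A powr r" using x0 A by (simp add: powr_divide)
  finally have "ln (x / A) \<le> x powr r / (r * A powr r)"
    using assms(3) A by (simp add: field_simps)
  then show ?thesis using x0 A unfolding c m by (simp add: ln_div)
qed

lemma continuous_on_clamp_log: "0 < A \<Longrightarrow> continuous_on UNIV (clamp_log A)"
  unfolding clamp_log_def[abs_def]
  by (intro continuous_intros ballI less_imp_neq[THEN not_sym]) (simp add: less_max_iff_disj)

lemma tendsto_clamp_log:
  "0 < A \<Longrightarrow> (f \<longlongrightarrow> l) F \<Longrightarrow> ((\<lambda>x. clamp_log A (f x)) \<longlongrightarrow> clamp_log A l) F"
  using continuous_on_clamp_log[of A]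
  by (auto simp: continuous_on_eq_continuous_at intro: isCont_tendsto_compose)

lemma borel_measurable_clamp_log [measurable]: "clamp_log A \<in> borel_measurable borel"
  unfolding clamp_log_def[abs_def] by measurable

section \<open>Removing the shift\<close>

lemma boundary_values_vertical:
  assumes "boundary_values F f" "\<And>n. 0 < y n" "y \<longlonglongrightarrow> 0"
  shows "AE x in lebesgue. (\<lambda>n. F (Complex x (y n))) \<longlonglongrightarrow> f x"
  using assms(1) unfolding boundary_values_def
proof eventually_elim
  case (elim x)
  \<comment> \<open>One aperture suffices: the vertical half-line above x lies in every cone, in
    particular in that of aperture 1.\<close>
  then have "(F \<longlongrightarrow> f x) (at (complex_of_real x) within {z. 0 < Im z \<and> \<bar>Re z - x\<bar> < 1 * Im z})"
    using zero_less_one by blast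
  moreover have "filterlim (\<lambda>n. Complex x (y n))
      (at (complex_of_real x) within {z. 0 < Im z \<and> \<bar>Re z - x\<bar> < 1 * Im z}) sequentially"
    unfolding filterlim_at
  proof
    show "\<forall>\<^sub>F n in sequentially. Complex x (y n) \<in> {z. 0 < Im z \<and> \<bar>Re z - x\<bar> < 1 * Im z} \<and>
        Complex x (y n) \<noteq> complex_of_real x"
      using assms(2) by (auto simp: complex_eq_iff less_imp_neq[symmetric] intro!: always_eventually)
    show "(\<lambda>n. Complex x (y n)) \<longlonglongrightarrow> complex_of_real x"
      using tendsto_Complex[OF tendsto_const assms(3), of x] by (simp add: complex_of_real_def)
  qed
  ultimately show ?case by (rule filterlim_compose)
qed

text \<open>The bounded case is applied to the shift of \<open>K\<close> by y, and the untruncated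
  upper part is paid for by the last term in the exponent. That term contains only \<open>M\<close>,
  not y, so it survives the limit y -> 0 unchanged.\<close>

lemma norm_le_exp_clamp_log:
  assumes hol: "K holomorphic_on upper_half_plane"
    and bdd: "\<And>e. 0 < e \<Longrightarrow> \<exists>L. \<forall>z. e \<le> Im z \<longrightarrow> norm (K z) \<le> L"
    and r: "0 < r" and M: "0 \<le> M"
      "\<And>y. 0 < y \<Longrightarrow> (\<integral>\<^sup>+x. ennreal (norm (K (Complex x y)) powr r) \<partial>lebesgue) \<le> ennreal M"
    and A: "1 \<le> A" and y: "0 < y" and z: "0 < Im z"
  shows "norm (K (z + \<i> * of_real y)) \<le>
     exp ((\<integral>t. clamp_log A (norm (K (Complex t y))) * poisson_kernel z t \<partial>lebesgue)
          + M / (pi * Im z) / (r * A powr r))"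
proof -
  define F where "F w = K (w + \<i> * of_real y)" for w
  have Ft: "F (complex_of_real t) = K (Complex t y)" for t by (simp add: F_def Complex_eq)
  obtain L where L: "\<And>z. y \<le> Im z \<Longrightarrow> norm (K z) \<le> L" using bdd[OF y] by blast
  have cK: "continuous_on upper_half_plane K" using hol by (rule holomorphic_on_imp_continuous_on)
  have cF: "continuous_on {z. 0 \<le> Im z} F"
    unfolding F_def by (rule continuous_on_compose2[OF cK]) (use y in \<open>auto intro!: continuous_intros\<close>)
  have hF: "F holomorphic_on upper_half_plane"
    unfolding F_def using y
    by (intro holomorphic_on_compose_gen[OF _ hol, unfolded comp_def]) (auto intro!: holomorphic_intros)
  have bF: "norm (F w) \<le> L" if "0 \<le> Im w" for w unfolding F_def using that by (intro L) simp
  define g where "g t = norm (K (Complex t y))" for t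
  have cg: "continuous_on UNIV g"
    unfolding g_def Ft[symmetric]
    by (intro continuous_intros continuous_on_compose2[OF cF]) auto
  then have gb[measurable]: "g \<in> borel_measurable borel" by (rule borel_measurable_continuous_onI)
  have [measurable]: "g \<in> borel_measurable lebesgue" by (rule borel_measurable_lebesgueI[OF gb])
  have g0: "0 \<le> g t" for t by (simp add: g_def)
  have igr: "integrable lebesgue (\<lambda>t. g t powr r)"
  proof (rule integrableI_bounded)
    show "(\<integral>\<^sup>+t. ennreal (norm (g t powr r)) \<partial>lebesgue) < \<infinity>"
      using le_less_trans[OF M(2)[OF y] ennreal_less_top] by (simp add: g_def)
  qed measurable
  have "ennreal (\<integral>t. g t powr r \<partial>lebesgue) = (\<integral>\<^sup>+t. ennreal (g t powr r) \<partial>lebesgue)"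
    using igr by (intro nn_integral_eq_integral[symmetric]) auto
  also have "\<dots> \<le> ennreal M" using M(2)[OF y] by (simp add: g_def)
  finally have gM: "(\<integral>t. g t powr r \<partial>lebesgue) \<le> M" using M(1) by simp
  define c where "c = 1 / (r * A powr r)"
  have c: "0 \<le> c" using r by (simp add: c_def)
  have i1: "integrable lebesgue (\<lambda>t. clamp_log A (g t) * poisson_kernel z t)"
    by (rule integrable_mult_poisson_kernel_bounded[OF z _ clamp_log_bounds[OF A]]) measurable
  have i2: "integrable lebesgue (\<lambda>t. g t powr r * poisson_kernel z t)"
    by (rule integrable_mult_poisson_kernel_nonneg[OF z igr]) simp
  have gL: "g t \<le> L" for t unfolding g_def by (intro L) simp
  have L0: "0 \<le> L" using order_trans[OF g0 gL] .
  have i0: "integrable lebesgue (\<lambda>t. ln (max (g t) (1 / A)) * poisson_kernel z t)"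
  proof (rule integrable_mult_poisson_kernel_bounded[OF z])
    fix t
    have A': "0 < 1 / A" using A by simp
    have "ln (1 / A) \<le> ln (max (g t) (1 / A))" using A' by (subst ln_le_cancel_iff) (auto simp: less_max_iff_disj)
    moreover have "ln (max (g t) (1 / A)) \<le> ln (max L (1 / A))"
      using A' gL[of t] by (subst ln_le_cancel_iff) (auto simp: less_max_iff_disj le_max_iff_disj)
    ultimately show "\<bar>ln (max (g t) (1 / A))\<bar> \<le> \<bar>ln (1 / A)\<bar> + \<bar>ln (max L (1 / A))\<bar>" by linarith
  qed measurable
  have "(\<integral>t. ln (max (g t) (1 / A)) * poisson_kernel z t \<partial>lebesgue)
      \<le> (\<integral>t. clamp_log A (g t) * poisson_kernel z t + c * (g t powr r * poisson_kernel z t) \<partial>lebesgue)"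
  proof (rule integral_mono)
    show "integrable lebesgue (\<lambda>t. clamp_log A (g t) * poisson_kernel z t + c * (g t powr r * poisson_kernel z t))"
      using i1 i2 by simp
    fix t
    have "ln (max (g t) (1 / A)) * poisson_kernel z t \<le> (clamp_log A (g t) + c * g t powr r) * poisson_kernel z t"
      using ln_max_le_clamp_log[OF A g0 r, of t] z poisson_kernel_nonneg[of z t]
      by (intro mult_right_mono) (auto simp: c_def)
    then show "ln (max (g t) (1 / A)) * poisson_kernel z t
        \<le> clamp_log A (g t) * poisson_kernel z t + c * (g t powr r * poisson_kernel z t)"
      by (simp add: algebra_simps)
  qed (fact i0)
  also have "\<dots> = (\<integral>t. clamp_log A (g t) * poisson_kernel z t \<partial>lebesgue)
        + c * (\<integral>t. g t powr r * poisson_kernel z t \<partial>lebesgue)"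
    using i1 i2 by simp
  also have "c * (\<integral>t. g t powr r * poisson_kernel z t \<partial>lebesgue) \<le> c * (M / (pi * Im z))"
  proof (rule mult_left_mono[OF _ c])
    have "(\<integral>t. g t powr r * poisson_kernel z t \<partial>lebesgue) \<le> (\<integral>t. g t powr r \<partial>lebesgue) / (pi * Im z)"
      by (rule poisson_integral_le_integral[OF z igr]) simp
    also have "\<dots> \<le> M / (pi * Im z)" using gM z by (intro divide_right_mono) auto
    finally show "(\<integral>t. g t powr r * poisson_kernel z t \<partial>lebesgue) \<le> M / (pi * Im z)" .
  qed
  finally have *: "(\<integral>t. ln (max (g t) (1 / A)) * poisson_kernel z t \<partial>lebesgue)
     \<le> (\<integral>t. clamp_log A (g t) * poisson_kernel z t \<partial>lebesgue) + M / (pi * Im z) / (r * A powr r)"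
    by (simp add: c_def mult_ac)
  \<comment> \<open>The floor is taken to be 1/A, the lower truncation level of
    \<open>clamp_log A\<close>, so that only values above A need the error term.\<close>
  have "norm (F z) \<le> exp (\<integral>t. ln (max (norm (F (complex_of_real t))) (1 / A)) * poisson_kernel z t \<partial>lebesgue)"
    by (rule norm_le_exp_poisson_integral_bounded[OF hF cF bF _ z]) (use A in auto)
  also have "\<dots> \<le> exp ((\<integral>t. clamp_log A (g t) * poisson_kernel z t \<partial>lebesgue) + M / (pi * Im z) / (r * A powr r))"
    using * by (simp add: Ft g_def)
  finally show ?thesis by (simp add: F_def g_def)
qed

text \<open>Two limits in a fixed order. For fixed A, ln A times the Poisson kernel is a majorant
  for all shifts; then A tends to infinity under the majorant |ln u|. The function \<open>u\<close>
  stands in for |k|, whose logarithm is not assumed integrable against the weight.\<close>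

lemma norm_le_exp_poisson_integral:
  assumes hol: "K holomorphic_on upper_half_plane"
    and bdd: "\<And>e. 0 < e \<Longrightarrow> \<exists>L. \<forall>z. e \<le> Im z \<longrightarrow> norm (K z) \<le> L"
    and r: "0 < r" and M: "0 \<le> M"
      "\<And>y. 0 < y \<Longrightarrow> (\<integral>\<^sup>+x. ennreal (norm (K (Complex x y)) powr r) \<partial>lebesgue) \<le> ennreal M"
    and bv: "boundary_values K k"
    and [measurable]: "k \<in> borel_measurable lebesgue" "u \<in> borel_measurable lebesgue"
    and u: "AE t in lebesgue. 0 < u t \<and> norm (k t) \<le> u t"
    and iu: "integrable lebesgue (\<lambda>t. \<bar>ln (u t)\<bar> / (1 + t\<^sup>2))"
    and z: "0 < Im z"
  shows "norm (K z) \<le> exp (\<integral>t. ln (u t) * poisson_kernel z t \<partial>lebesgue)"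
proof -
  have cK: "continuous_on upper_half_plane K" using hol by (rule holomorphic_on_imp_continuous_on)
  define y where "y n = inverse (real (Suc n))" for n
  have y: "0 < y n" for n by (simp add: y_def)
  have y0: "y \<longlonglongrightarrow> 0" unfolding y_def by (rule LIMSEQ_inverse_real_of_nat)
  have m[measurable]: "(\<lambda>t. K (Complex t (y n))) \<in> borel_measurable lebesgue" for n
  proof (rule borel_measurable_lebesgueI[OF borel_measurable_continuous_onI])
    show "continuous_on UNIV (\<lambda>t. K (Complex t (y n)))"
      by (rule continuous_on_compose2[OF cK]) (use y in \<open>auto simp: Complex_eq intro!: continuous_intros\<close>)
  qed
  have clamped: "norm (K z) \<le> exp ((\<integral>t. clamp_log A (u t) * poisson_kernel z t \<partial>lebesgue)
          + M / (pi * Im z) / (r * A powr r))" if A: "1 \<le> A" for A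
  proof -
    have "(\<lambda>n. norm (K (z + \<i> * of_real (y n)))) \<longlonglongrightarrow> norm (K z)"
    proof (intro tendsto_norm isCont_tendsto_compose[of z K])
      show "isCont K z" using cK z continuous_on_eq_continuous_at[OF open_upper_half_plane, of K] by simp
      have "(\<lambda>n. z + \<i> * of_real (y n)) \<longlonglongrightarrow> z + \<i> * of_real 0" by (intro tendsto_intros y0)
      then show "(\<lambda>n. z + \<i> * of_real (y n)) \<longlonglongrightarrow> z" by simp
    qed
    moreover have "(\<lambda>n. \<integral>t. clamp_log A (norm (K (Complex t (y n)))) * poisson_kernel z t \<partial>lebesgue)
        \<longlonglongrightarrow> (\<integral>t. clamp_log A (norm (k t)) * poisson_kernel z t \<partial>lebesgue)"
    proof (rule integral_dominated_convergence)
      show "integrable lebesgue (\<lambda>t. ln A * poisson_kernel z t)"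
        using integrable_poisson_kernel[OF z] by simp
      show "AE t in lebesgue. (\<lambda>n. clamp_log A (norm (K (Complex t (y n)))) * poisson_kernel z t)
          \<longlonglongrightarrow> clamp_log A (norm (k t)) * poisson_kernel z t"
        using boundary_values_vertical[OF bv y y0]
      proof eventually_elim
        case (elim t)
        then show ?case using A by (intro tendsto_mult tendsto_const tendsto_clamp_log tendsto_norm) auto
      qed
      show "AE t in lebesgue. norm (clamp_log A (norm (K (Complex t (y n)))) * poisson_kernel z t)
          \<le> ln A * poisson_kernel z t" for n
        using clamp_log_bounds[OF A] poisson_kernel_nonneg[of z] z
        by (intro AE_I2) (auto simp: abs_mult intro!: mult_right_mono)
    qed measurable
    ultimately have "norm (K z) \<le> exp ((\<integral>t. clamp_log A (norm (k t)) * poisson_kernel z t \<partial>lebesgue)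
          + M / (pi * Im z) / (r * A powr r))"
      using norm_le_exp_clamp_log[OF hol bdd r M A y z]
      by (intro LIMSEQ_le[OF _ tendsto_exp[OF tendsto_add[OF _ tendsto_const]]]) auto
    \<comment> \<open>The passage from |k| to \<open>u\<close> takes place while the logarithms are
      truncated, where monotonicity holds even at zeros of k.\<close>
    also have "\<dots> \<le> exp ((\<integral>t. clamp_log A (u t) * poisson_kernel z t \<partial>lebesgue)
          + M / (pi * Im z) / (r * A powr r))"
    proof -
      have "(\<integral>t. clamp_log A (norm (k t)) * poisson_kernel z t \<partial>lebesgue)
          \<le> (\<integral>t. clamp_log A (u t) * poisson_kernel z t \<partial>lebesgue)"
      proof (rule integral_mono_AE)
        show "AE t in lebesgue. clamp_log A (norm (k t)) * poisson_kernel z t \<le> clamp_log A (u t) * poisson_kernel z t"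
          using u
        proof eventually_elim
          case (elim t)
          then show ?case
            using clamp_log_mono[OF A] poisson_kernel_nonneg[of z] z by (intro mult_right_mono) auto
        qed
      qed (rule integrable_mult_poisson_kernel_bounded[OF z _ clamp_log_bounds[OF A]], measurable)+
      then show ?thesis by simp
    qed
    finally show ?thesis .
  qed
  have nat: "1 \<le> real (Suc n)" for n by simp
  have "(\<lambda>n. \<integral>t. clamp_log (real (Suc n)) (u t) * poisson_kernel z t \<partial>lebesgue)
      \<longlonglongrightarrow> (\<integral>t. ln (u t) * poisson_kernel z t \<partial>lebesgue)"
  proof (rule integral_dominated_convergence)
    have "integrable lebesgue (\<lambda>t. ln (u t) * poisson_kernel z t)"
      by (rule integrable_mult_poisson_kernel[OF z _ iu]) measurable
    from integrable_abs[OF this] show "integrable lebesgue (\<lambda>t. \<bar>ln (u t)\<bar> * poisson_kernel z t)"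
      using poisson_kernel_nonneg[of z] z by (simp add: abs_mult)
    show "AE t in lebesgue. (\<lambda>n. clamp_log (real (Suc n)) (u t) * poisson_kernel z t)
        \<longlonglongrightarrow> ln (u t) * poisson_kernel z t"
      using u
    proof eventually_elim
      case (elim t)
      then have u0: "0 < u t" by simp
      \<comment> \<open>From \<open>N\<close> on, both u t and 1 / u t lie below the truncation
        level, so the truncated logarithm is the logarithm itself.\<close>
      obtain N where N: "max (u t) (1 / u t) < real N" using reals_Archimedean2 by blast
      have "clamp_log (real (Suc n)) (u t) = ln (u t)" if "N \<le> n" for n
      proof -
        have "u t \<le> real (Suc n)" "1 / u t \<le> real (Suc n)" using N that by auto
        then have "1 / real (Suc n) \<le> u t" using u0 by (simp add: divide_le_eq mult.commute)
        with \<open>u t \<le> real (Suc n)\<close> show ?thesis by (simp only: clamp_log_def min_absorb1 max_absorb2)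
      qed
      then have "\<forall>\<^sub>F n in sequentially. clamp_log (real (Suc n)) (u t) = ln (u t)"
        by (auto simp: eventually_sequentially)
      then show ?case by (intro tendsto_mult tendsto_const tendsto_eventually)
    qed
    show "AE t in lebesgue. norm (clamp_log (real (Suc n)) (u t) * poisson_kernel z t)
        \<le> \<bar>ln (u t)\<bar> * poisson_kernel z t" for n
      using u
    proof eventually_elim
      case (elim t)
      then have "\<bar>clamp_log (real (Suc n)) (u t)\<bar> \<le> \<bar>ln (u t)\<bar>"
        using abs_clamp_log_le_abs_ln[OF nat] by blast
      moreover have "0 \<le> poisson_kernel z t" using z by (simp add: poisson_kernel_nonneg)
      ultimately show ?case
        by (simp add: abs_mult mult_right_mono)
    qed
  qed measurable
  moreover have "(\<lambda>n. M / (pi * Im z) / (r * real (Suc n) powr r)) \<longlonglongrightarrow> 0"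
  proof -
    have "(\<lambda>n. real (Suc n) powr - r) \<longlonglongrightarrow> 0"
      by (rule tendsto_neg_powr[OF _ filterlim_compose[OF filterlim_real_sequentially filterlim_Suc]])
        (use r in simp)
    from tendsto_mult_left[OF this, of "M / (pi * Im z) / r"] show ?thesis
      by (simp add: powr_minus divide_inverse mult.assoc)
  qed
  ultimately have "(\<lambda>n. exp ((\<integral>t. clamp_log (real (Suc n)) (u t) * poisson_kernel z t \<partial>lebesgue)
          + M / (pi * Im z) / (r * real (Suc n) powr r)))
      \<longlonglongrightarrow> exp ((\<integral>t. ln (u t) * poisson_kernel z t \<partial>lebesgue) + 0)"
    by (intro tendsto_exp tendsto_add)
  then have "norm (K z) \<le> exp ((\<integral>t. ln (u t) * poisson_kernel z t \<partial>lebesgue) + 0)"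
    using clamped[OF nat] by (intro LIMSEQ_le_const) auto
  then show ?thesis by simp
qed

section \<open>The Smirnov maximum principle\<close>

text \<open>Jensen's inequality from a tangent line: exp s >= exp a * (1 + s - a), with a the
  Poisson mean of \<open>w\<close>, is integrated against the kernel, whose total mass is 1.\<close>

lemma exp_poisson_integral_le:
  assumes z: "0 < Im z" and w: "integrable lebesgue (\<lambda>t. w t * poisson_kernel z t)"
    and ew: "integrable lebesgue (\<lambda>t. exp (w t) * poisson_kernel z t)"
  shows "exp (\<integral>t. w t * poisson_kernel z t \<partial>lebesgue) \<le> (\<integral>t. exp (w t) * poisson_kernel z t \<partial>lebesgue)"
proof -
  define a where "a = (\<integral>t. w t * poisson_kernel z t \<partial>lebesgue)"
  have P: "integrable lebesgue (poisson_kernel z)" "(\<integral>t. poisson_kernel z t \<partial>lebesgue) = 1"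
    using z by (simp_all add: integrable_poisson_kernel integral_poisson_kernel)
  have i: "integrable lebesgue (\<lambda>t. exp a * ((1 - a) * poisson_kernel z t + w t * poisson_kernel z t))"
    using P w by simp
  have "exp a = (\<integral>t. exp a * ((1 - a) * poisson_kernel z t + w t * poisson_kernel z t) \<partial>lebesgue)"
    using P w by (simp add: a_def)
  also have "\<dots> \<le> (\<integral>t. exp (w t) * poisson_kernel z t \<partial>lebesgue)"
  proof (rule integral_mono[OF i ew])
    fix t
    have "exp a * (1 + (w t - a)) \<le> exp a * exp (w t - a)"
      by (intro mult_left_mono exp_ge_add_one_self) simp
    also have "\<dots> = exp (w t)" by (simp add: exp_add[symmetric])
    finally have "exp a * (1 + (w t - a)) * poisson_kernel z t \<le> exp (w t) * poisson_kernel z t"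
      using z by (intro mult_right_mono poisson_kernel_nonneg) auto
    then show "exp a * ((1 - a) * poisson_kernel z t + w t * poisson_kernel z t) \<le> exp (w t) * poisson_kernel z t"
      by (simp add: algebra_simps)
  qed
  finally show ?thesis by (simp add: a_def)
qed

text \<open>The kernel depends on x and t only through (t - x)^2, so it also has mass 1 in x, and
  Tonelli's theorem applies.\<close>

lemma nn_integral_poisson_integral:
  fixes f :: "real \<Rightarrow> real"
  assumes "f \<in> borel_measurable lebesgue" and y: "0 < y"
  shows "(\<integral>\<^sup>+x. (\<integral>\<^sup>+t. ennreal (f t) * ennreal (poisson_kernel (Complex x y) t) \<partial>lebesgue) \<partial>lebesgue)
       = (\<integral>\<^sup>+t. ennreal (f t) \<partial>lebesgue)"
proof -
  \<comment> \<open>Tonelli's theorem is applied to the product of two copies of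
    \<open>lborel\<close>, so a Borel version of f is needed for joint measurability.\<close>
  obtain f' where f'[measurable]: "f' \<in> borel_measurable lborel" and eq: "AE t in lborel. f t = f' t"
    using completion_ex_borel_measurable_real[OF assms(1)] by blast
  have [measurable]: "(\<lambda>(x, t). poisson_kernel (Complex x y) t) \<in> borel_measurable (lborel \<Otimes>\<^sub>M lborel)"
    unfolding poisson_kernel_eq by simp measurable
  have one: "(\<integral>\<^sup>+x. ennreal (poisson_kernel (Complex x y) t) \<partial>lborel) = 1" for t
  proof -
    have "poisson_kernel (Complex x y) t = poisson_kernel (Complex t y) x" for x
      by (simp add: poisson_kernel_eq power2_commute)
    then have "(\<integral>\<^sup>+x. ennreal (poisson_kernel (Complex x y) t) \<partial>lborel)
        = (\<integral>\<^sup>+x. ennreal (poisson_kernel (Complex t y) x) \<partial>lebesgue)"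
      by (simp add: nn_integral_completion)
    also have "\<dots> = ennreal 1"
      using y by (subst nn_integral_eq_integral)
        (auto simp: integrable_poisson_kernel integral_poisson_kernel poisson_kernel_nonneg)
    finally show ?thesis by simp
  qed
  have "(\<integral>\<^sup>+x. (\<integral>\<^sup>+t. ennreal (f t) * ennreal (poisson_kernel (Complex x y) t) \<partial>lebesgue) \<partial>lebesgue)
      = (\<integral>\<^sup>+x. (\<integral>\<^sup>+t. ennreal (f' t) * ennreal (poisson_kernel (Complex x y) t) \<partial>lborel) \<partial>lborel)"
    unfolding nn_integral_completion using eq
    by (intro nn_integral_cong nn_integral_cong_AE) auto
  also have "\<dots> = (\<integral>\<^sup>+t. (\<integral>\<^sup>+x. ennreal (f' t) * ennreal (poisson_kernel (Complex x y) t) \<partial>lborel) \<partial>lborel)"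
    by (rule lborel_pair.Fubini'[symmetric]) measurable
  also have "\<dots> = (\<integral>\<^sup>+t. ennreal (f' t) \<partial>lborel)"
    by (intro nn_integral_cong, subst nn_integral_cmult) (measurable, simp add: one)
  also have "\<dots> = (\<integral>\<^sup>+t. ennreal (f t) \<partial>lebesgue)"
    unfolding nn_integral_completion using eq by (intro nn_integral_cong_AE) auto
  finally show ?thesis .
qed

text \<open>Jensen's inequality for the probability density \<open>poisson_kernel z\<close>, followed by Tonelli's
  theorem on each horizontal line.\<close>

lemma mem_Hardy_if_le_exp_poisson_integral:
  assumes hol: "G holomorphic_on upper_half_plane" and p: "0 < p"
    and [measurable]: "m \<in> borel_measurable lebesgue" and m: "AE t in lebesgue. 0 < m t"
    and im: "integrable lebesgue (\<lambda>t. \<bar>ln (m t)\<bar> / (1 + t\<^sup>2))"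
    and mp: "integrable lebesgue (\<lambda>t. m t powr p)"
    and le: "\<And>z. 0 < Im z \<Longrightarrow> norm (G z) \<le> exp (\<integral>t. ln (m t) * poisson_kernel z t \<partial>lebesgue)"
  shows "G \<in> Hardy p"
proof -
  have pointwise: "ennreal (norm (G z) powr p)
      \<le> (\<integral>\<^sup>+t. ennreal (m t powr p) * ennreal (poisson_kernel z t) \<partial>lebesgue)" if z: "0 < Im z" for z
  proof -
    \<comment> \<open>Equality holds only where m t is nonzero: at 0 the left-hand exponential would
      be exp 0 = 1, while \<open>0 powr p\<close> is 0.\<close>
    have eq: "AE t in lebesgue. exp (p * ln (m t)) * poisson_kernel z t = m t powr p * poisson_kernel z t"
      using m by eventually_elim (simp add: powr_def)
    have i: "integrable lebesgue (\<lambda>t. m t powr p * poisson_kernel z t)"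
      by (rule integrable_mult_poisson_kernel_nonneg[OF z mp]) simp
    have e: "integrable lebesgue (\<lambda>t. exp (p * ln (m t)) * poisson_kernel z t)"
      using i eq by (subst integrable_cong_AE[OF _ _ eq]) measurable
    have l: "integrable lebesgue (\<lambda>t. ln (m t) * poisson_kernel z t)"
      by (rule integrable_mult_poisson_kernel[OF z _ im]) measurable
    have "norm (G z) powr p \<le> exp (\<integral>t. ln (m t) * poisson_kernel z t \<partial>lebesgue) powr p"
      using le[OF z] p by (intro powr_mono2) auto
    also have "\<dots> = exp (\<integral>t. p * ln (m t) * poisson_kernel z t \<partial>lebesgue)"
      by (simp add: powr_def mult.assoc)
    also have "\<dots> \<le> (\<integral>t. exp (p * ln (m t)) * poisson_kernel z t \<partial>lebesgue)"
      using integrable_mult_right[OF l, of p] e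
      by (intro exp_poisson_integral_le[OF z]) (simp_all add: mult.assoc)
    also have "\<dots> = (\<integral>t. m t powr p * poisson_kernel z t \<partial>lebesgue)"
      by (rule integral_cong_AE[OF _ _ eq]) measurable
    finally have "ennreal (norm (G z) powr p) \<le> ennreal (\<integral>t. m t powr p * poisson_kernel z t \<partial>lebesgue)"
      by (rule ennreal_leI)
    also have "\<dots> = (\<integral>\<^sup>+t. ennreal (m t powr p * poisson_kernel z t) \<partial>lebesgue)"
      using i z by (intro nn_integral_eq_integral[symmetric]) (auto simp: poisson_kernel_nonneg)
    finally show ?thesis using z by (simp add: ennreal_mult poisson_kernel_nonneg)
  qed
  have "(\<integral>\<^sup>+x. ennreal (norm (G (Complex x y)) powr p) \<partial>lebesgue) \<le> (\<integral>\<^sup>+t. ennreal (m t powr p) \<partial>lebesgue)"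
    if y: "0 < y" for y
  proof -
    have "(\<integral>\<^sup>+x. ennreal (norm (G (Complex x y)) powr p) \<partial>lebesgue)
       \<le> (\<integral>\<^sup>+x. (\<integral>\<^sup>+t. ennreal (m t powr p) * ennreal (poisson_kernel (Complex x y) t) \<partial>lebesgue) \<partial>lebesgue)"
      using y by (intro nn_integral_mono pointwise) simp
    also have "\<dots> = (\<integral>\<^sup>+t. ennreal (m t powr p) \<partial>lebesgue)"
      by (rule nn_integral_poisson_integral[OF _ y]) measurable
    finally show ?thesis .
  qed
  then have "(SUP y\<in>{0<..}. \<integral>\<^sup>+x. ennreal (norm (G (Complex x y)) powr p) \<partial>lebesgue)
      \<le> (\<integral>\<^sup>+t. ennreal (m t powr p) \<partial>lebesgue)"
    by (intro SUP_least) auto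
  also have "\<dots> = ennreal (\<integral>t. m t powr p \<partial>lebesgue)"
    using mp by (intro nn_integral_eq_integral) auto
  also have "\<dots> < \<infinity>" by simp
  finally show ?thesis using hol by (simp add: Hardy_def)
qed

lemma borel_measurable_one_plus_square_lebesgue [measurable]:
  "(\<lambda>t::real. 1 + t\<^sup>2) \<in> borel_measurable lebesgue"
  by (rule borel_measurable_lebesgueI) measurable

lemma integrable_abs_div_one_plus_square_bound:
  fixes w :: "real \<Rightarrow> real"
  assumes v: "integrable lebesgue (\<lambda>t. \<bar>v t\<bar> / (1 + t\<^sup>2))" and [measurable]: "w \<in> borel_measurable lebesgue"
    and "AE t in lebesgue. \<bar>w t\<bar> \<le> \<bar>v t\<bar>"
  shows "integrable lebesgue (\<lambda>t. \<bar>w t\<bar> / (1 + t\<^sup>2))" "integrable lebesgue (\<lambda>t. w t / (1 + t\<^sup>2))"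
  using assms(3) by (auto intro!: Bochner_Integration.integrable_bound[OF v] elim!: eventually_mono
      simp: divide_right_mono)

text \<open>The equality for the modulus is the point: it bounds a quotient by an outer function
  from above, where an upper bound for the denominator would be of no use.\<close>

lemma outer_function_extension:
  assumes "outer_function q"
  obtains E where "E holomorphic_on upper_half_plane" "boundary_values E q"
    "\<And>z. 0 < Im z \<Longrightarrow> norm (E z) = exp (\<integral>t. ln (norm (q t)) * poisson_kernel z t \<partial>lebesgue)"
proof -
  from assms obtain c where [measurable]: "q \<in> borel_measurable lebesgue"
    and int: "integrable lebesgue (\<lambda>t. \<bar>ln (norm (q t))\<bar> / (1 + t\<^sup>2))" and c: "norm c = 1"
    and bv: "boundary_values (\<lambda>\<xi>. c * exp (schwarz_integral (\<lambda>t. ln (norm (q t))) \<xi>)) q"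
    unfolding outer_function_def schwarz_integral_def by blast
  have i: "integrable lebesgue (\<lambda>t. ln (norm (q t)) / (1 + t\<^sup>2))"
    by (rule integrable_abs_div_one_plus_square_bound[OF int]) auto
  show thesis
  proof (rule that[OF _ bv])
    show "(\<lambda>\<xi>. c * exp (schwarz_integral (\<lambda>t. ln (norm (q t))) \<xi>)) holomorphic_on upper_half_plane"
      by (intro holomorphic_intros holomorphic_schwarz_integral i)
    show "norm (c * exp (schwarz_integral (\<lambda>t. ln (norm (q t))) z))
        = exp (\<integral>t. ln (norm (q t)) * poisson_kernel z t \<partial>lebesgue)" if "0 < Im z" for z
      using c Re_schwarz_integral[OF that i] by (simp add: norm_mult norm_exp_eq_Re)
  qed
qed

section \<open>Boundary values and comparison in L^p\<close>

lemma boundary_values_mult: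
  assumes "boundary_values F f" "boundary_values G g"
  shows "boundary_values (\<lambda>z. F z * G z) (\<lambda>x. f x * g x)"
  using assms unfolding boundary_values_def
  by eventually_elim (auto intro!: tendsto_mult)

lemma boundary_values_divide:
  assumes "boundary_values F f" "boundary_values G g" "AE x in lebesgue. g x \<noteq> 0"
  shows "boundary_values (\<lambda>z. F z / G z) (\<lambda>x. f x / g x)"
  using assms unfolding boundary_values_def
  by eventually_elim (auto intro!: tendsto_divide)

lemma boundary_values_cong_AE:
  assumes "boundary_values F f" "AE x in lebesgue. f x = g x"
  shows "boundary_values F g"
  using assms unfolding boundary_values_def by eventually_elim simp

lemma Lp_bound:
  assumes f: "f \<in> Lp p" and [measurable]: "g \<in> borel_measurable lebesgue" and p: "0 \<le> p" and c: "0 \<le> c"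
    and le: "AE x in lebesgue. norm (g x) \<le> c * norm (f x)"
  shows "g \<in> Lp p"
proof -
  have "integrable lebesgue (\<lambda>x. norm (g x) powr p)"
  proof (rule Bochner_Integration.integrable_bound)
    show "integrable lebesgue (\<lambda>x. c powr p * norm (f x) powr p)"
      using f by (intro integrable_mult_right) (simp add: Lp_def)
    show "AE x in lebesgue. norm (norm (g x) powr p) \<le> norm (c powr p * norm (f x) powr p)"
      using le
    proof eventually_elim
      case (elim x)
      then have "norm (g x) powr p \<le> (c * norm (f x)) powr p" using p by (intro powr_mono2) auto
      then show ?case using c by (simp add: powr_mult)
    qed
  qed measurable
  then show ?thesis by (simp add: Lp_def)
qed

lemma Hp_plus_cong_AE:
  assumes f: "f \<in> Hp_plus p" and g: "g \<in> borel_measurable lebesgue" and p: "0 \<le> p"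
    and eq: "AE x in lebesgue. f x = g x"
  shows "g \<in> Hp_plus p"
proof -
  have "g \<in> Lp p"
    by (rule Lp_bound[where c = 1, OF _ g p]) (use f eq in \<open>auto simp: Hp_plus_def elim: eventually_mono\<close>)
  then show ?thesis using f boundary_values_cong_AE[OF _ eq] unfolding Hp_plus_def by blast
qed

text \<open>The arithmetic-geometric mean inequality, applied pointwise: it bounds the means of
  order p/2 of a product by the sum of the means of order p of the factors.\<close>

lemma powr_half_mult_le:
  fixes a b :: real
  assumes "0 \<le> a" "0 \<le> b"
  shows "(a * b) powr (p / 2) \<le> a powr p + b powr p"
proof -
  have sq: "(x powr (p / 2))\<^sup>2 = x powr p" for x :: real
    by (simp add: power2_eq_square powr_add[symmetric])
  have "2 * (a powr (p / 2) * b powr (p / 2)) \<le> a powr p + b powr p"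
    using sum_squares_bound[of "a powr (p / 2)" "b powr (p / 2)"] by (simp add: sq mult.assoc)
  moreover have "(a * b) powr (p / 2) = a powr (p / 2) * b powr (p / 2)"
    using assms by (simp add: powr_mult)
  moreover have "0 \<le> a powr (p / 2) * b powr (p / 2)" by simp
  ultimately show ?thesis by linarith
qed

text \<open>\<open>g * \<psi>\<close> is the boundary function of a product, hence dominated by the exponential of the
  Poisson integral of \<open>ln (\<bar>Q\<bar> * \<bar>W\<bar> * max \<bar>\<gamma>\<bar> \<bar>W\<bar>)\<close>; taking the maximum with \<open>\<bar>W\<bar>\<close> makes this logarithm
  integrable even if \<open>\<gamma>\<close> vanishes somewhere.\<close>

lemma smirnov_quotient_mem_Hp_plus:
  assumes p: "1 < p" and g: "g \<in> Hp_plus p" and \<psi>: "\<psi> \<in> Hp_plus p"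
    and Q: "outer_function Q" and W: "outer_function W" "W \<in> Lp p"
    and \<gamma>: "\<gamma> \<in> Lp p" and eq: "AE x in lebesgue. \<gamma> x = g x * \<psi> x / (Q x * W x)"
  shows "\<gamma> \<in> Hp_plus p"
proof -
  obtain F where F: "F \<in> Hardy p" "boundary_values F g" using g by (auto simp: Hp_plus_def)
  obtain \<Psi> where \<Psi>: "\<Psi> \<in> Hardy p" "boundary_values \<Psi> \<psi>" using \<psi> by (auto simp: Hp_plus_def)
  obtain EQ where EQ: "EQ holomorphic_on upper_half_plane" "boundary_values EQ Q"
    "\<And>z. 0 < Im z \<Longrightarrow> norm (EQ z) = exp (\<integral>t. ln (norm (Q t)) * poisson_kernel z t \<partial>lebesgue)"
    using outer_function_extension[OF Q] by metis
  obtain EW where EW: "EW holomorphic_on upper_half_plane" "boundary_values EW W"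
    "\<And>z. 0 < Im z \<Longrightarrow> norm (EW z) = exp (\<integral>t. ln (norm (W t)) * poisson_kernel z t \<partial>lebesgue)"
    using outer_function_extension[OF W(1)] by metis
  have [measurable]: "Q \<in> borel_measurable lebesgue" "W \<in> borel_measurable lebesgue"
    "g \<in> borel_measurable lebesgue" "\<psi> \<in> borel_measurable lebesgue" "\<gamma> \<in> borel_measurable lebesgue"
    using Q W g \<psi> \<gamma> by (auto simp: outer_function_def Lp_def Hp_plus_def)
  have nz: "AE x in lebesgue. Q x \<noteq> 0" "AE x in lebesgue. W x \<noteq> 0"
    using Q W by (auto simp: outer_function_def)
  have iQ: "integrable lebesgue (\<lambda>t. \<bar>ln (norm (Q t))\<bar> / (1 + t\<^sup>2))"
    and iW: "integrable lebesgue (\<lambda>t. \<bar>ln (norm (W t))\<bar> / (1 + t\<^sup>2))"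
    using Q W by (auto simp: outer_function_def)
  have W_p: "integrable lebesgue (\<lambda>t. norm (W t) powr p)"
    and \<gamma>_p: "integrable lebesgue (\<lambda>t. norm (\<gamma> t) powr p)"
    using W \<gamma> by (auto simp: Lp_def)
  define K where "K z = F z * \<Psi> z" for z
  define m where "m t = max (norm (\<gamma> t)) (norm (W t))" for t
  have [measurable]: "m \<in> borel_measurable lebesgue" unfolding m_def by measurable
  have m0: "AE t in lebesgue. 0 < m t" using nz(2) by eventually_elim (simp add: m_def less_max_iff_disj)
  have mp: "integrable lebesgue (\<lambda>t. m t powr p)"
  proof (rule Bochner_Integration.integrable_bound)
    show "integrable lebesgue (\<lambda>t. norm (\<gamma> t) powr p + norm (W t) powr p)" using W_p \<gamma>_p by simp
  qed (measurable, auto simp: m_def max_def)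
  have im: "integrable lebesgue (\<lambda>t. \<bar>ln (m t)\<bar> / (1 + t\<^sup>2))"
  proof (rule Bochner_Integration.integrable_bound)
    show "integrable lebesgue (\<lambda>t. \<bar>ln (norm (W t))\<bar> / (1 + t\<^sup>2) + norm (\<gamma> t) powr p)" using iW \<gamma>_p by simp
    show "AE t in lebesgue. norm (\<bar>ln (m t)\<bar> / (1 + t\<^sup>2)) \<le> norm (\<bar>ln (norm (W t))\<bar> / (1 + t\<^sup>2) + norm (\<gamma> t) powr p)"
      using nz(2)
    proof eventually_elim
      case (elim t)
      \<comment> \<open>Since m >= |W|, the negative part of ln m is at most that of ln |W|. Where
        |\<gamma>| exceeds |W|, the positive part is bounded by |\<gamma>|^p, which is integrable
        even without the weight.\<close>
      have "\<bar>ln (m t)\<bar> \<le> \<bar>ln (norm (W t))\<bar> + norm (\<gamma> t) powr p"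
      proof (cases "norm (\<gamma> t) \<le> norm (W t)")
        case True
        then show ?thesis by (simp add: m_def)
      next
        case False
        then have g0: "0 < norm (\<gamma> t)" and mg: "m t = norm (\<gamma> t)" by (auto simp: m_def)
        have "ln (norm (W t)) \<le> ln (norm (\<gamma> t))" using elim False g0 by (subst ln_le_cancel_iff) auto
        moreover have "ln (norm (\<gamma> t)) \<le> norm (\<gamma> t) powr p"
        proof (cases "1 \<le> norm (\<gamma> t)")
          case True
          have "ln (norm (\<gamma> t)) \<le> norm (\<gamma> t) powr 1" using ln_less_self[OF g0] by simp
          also have "\<dots> \<le> norm (\<gamma> t) powr p" using True p by (intro powr_mono) auto
          finally show ?thesis .
        next
          case False
          then have "ln (norm (\<gamma> t)) \<le> 0" using g0 by simp
          then show ?thesis by (rule order_trans) simp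
        qed
        moreover have "0 \<le> norm (\<gamma> t) powr p" by simp
        ultimately show ?thesis unfolding mg by linarith
      qed
      then have "\<bar>ln (m t)\<bar> / (1 + t\<^sup>2) \<le> (\<bar>ln (norm (W t))\<bar> + norm (\<gamma> t) powr p) / (1 + t\<^sup>2)"
        by (intro divide_right_mono) auto
      also have "\<dots> \<le> \<bar>ln (norm (W t))\<bar> / (1 + t\<^sup>2) + norm (\<gamma> t) powr p"
        by (simp add: add_divide_distrib divide_le_eq mult_left_mono add_pos_nonneg mult_le_cancel_left1)
      finally show ?case by simp
    qed
  qed measurable
  \<comment> \<open>On the line |g \<psi>| = |Q W \<gamma>| <= u, and ln u is a sum of three terms
    integrable against the weight, two of which belong to the outer functions.\<close>
  define u where "u t = norm (Q t) * norm (W t) * m t" for t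
  have [measurable]: "u \<in> borel_measurable lebesgue" unfolding u_def by measurable
  have lnu: "AE t in lebesgue. ln (u t) = ln (norm (Q t)) + ln (norm (W t)) + ln (m t)"
    using nz m0 by eventually_elim (simp add: u_def ln_mult)
  have iu: "integrable lebesgue (\<lambda>t. \<bar>ln (u t)\<bar> / (1 + t\<^sup>2))"
  proof (rule Bochner_Integration.integrable_bound)
    show "integrable lebesgue (\<lambda>t. \<bar>ln (norm (Q t))\<bar> / (1 + t\<^sup>2) + \<bar>ln (norm (W t))\<bar> / (1 + t\<^sup>2) + \<bar>ln (m t)\<bar> / (1 + t\<^sup>2))"
      using iQ iW im by simp
    show "AE t in lebesgue. norm (\<bar>ln (u t)\<bar> / (1 + t\<^sup>2))
        \<le> norm (\<bar>ln (norm (Q t))\<bar> / (1 + t\<^sup>2) + \<bar>ln (norm (W t))\<bar> / (1 + t\<^sup>2) + \<bar>ln (m t)\<bar> / (1 + t\<^sup>2))"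
      using lnu
    proof eventually_elim
      case (elim t)
      have "\<bar>ln (u t)\<bar> / (1 + t\<^sup>2) \<le> (\<bar>ln (norm (Q t))\<bar> + \<bar>ln (norm (W t))\<bar> + \<bar>ln (m t)\<bar>) / (1 + t\<^sup>2)"
        unfolding elim by (intro divide_right_mono) auto
      then show ?case by (simp add: add_divide_distrib)
    qed
  qed measurable
  obtain M1 where M1: "0 \<le> M1"
    "\<And>y. 0 < y \<Longrightarrow> (\<integral>\<^sup>+x. ennreal (norm (F (Complex x y)) powr p) \<partial>lebesgue) \<le> ennreal M1"
    using Hardy_mean_bound[OF F(1)] by blast
  obtain M2 where M2: "0 \<le> M2"
    "\<And>y. 0 < y \<Longrightarrow> (\<integral>\<^sup>+x. ennreal (norm (\<Psi> (Complex x y)) powr p) \<partial>lebesgue) \<le> ennreal M2"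
    using Hardy_mean_bound[OF \<Psi>(1)] by blast
  have holF: "F holomorphic_on upper_half_plane" and hol\<Psi>: "\<Psi> holomorphic_on upper_half_plane"
    using F \<Psi> by (auto simp: Hardy_def)
  have line: "(\<lambda>x. ennreal (norm (H (Complex x y)) powr p)) \<in> borel_measurable lebesgue"
    if "H holomorphic_on upper_half_plane" "0 < y" for H y
  proof -
    have "continuous_on UNIV (\<lambda>x. H (Complex x y))"
      by (rule continuous_on_compose2[OF holomorphic_on_imp_continuous_on[OF that(1)]])
        (use that in \<open>auto simp: Complex_eq intro!: continuous_intros\<close>)
    then have [measurable]: "(\<lambda>x. H (Complex x y)) \<in> borel_measurable lebesgue"
      by (intro borel_measurable_lebesgueI borel_measurable_continuous_onI)
    show ?thesis by measurable
  qed
  have K: "norm (K z) \<le> exp (\<integral>t. ln (u t) * poisson_kernel z t \<partial>lebesgue)" if z: "0 < Im z" for z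
  \<comment> \<open>The exponent p/2 and the constant M1 + M2 come from
    \<open>powr_half_mult_le\<close> applied on each horizontal line.\<close>
  proof (rule norm_le_exp_poisson_integral[where r = "p / 2" and M = "M1 + M2" and k = "\<lambda>t. g t * \<psi> t"])
    show "K holomorphic_on upper_half_plane" unfolding K_def by (intro holomorphic_intros holF hol\<Psi>)
    show "\<exists>L. \<forall>z. e \<le> Im z \<longrightarrow> norm (K z) \<le> L" if e: "0 < e" for e
    proof -
      obtain L1 where L1: "\<And>z. e \<le> Im z \<Longrightarrow> norm (F z) \<le> L1"
        using Hardy_bounded[OF F(1) _ e] p by (metis less_imp_le)
      obtain L2 where L2: "\<And>z. e \<le> Im z \<Longrightarrow> norm (\<Psi> z) \<le> L2"
        using Hardy_bounded[OF \<Psi>(1) _ e] p by (metis less_imp_le)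
      have "norm (K z) \<le> L1 * L2" if "e \<le> Im z" for z
        unfolding K_def norm_mult
        by (intro mult_mono L1 L2 that norm_ge_zero order_trans[OF norm_ge_zero L1[OF that]])
      then show ?thesis by blast
    qed
    show "(\<integral>\<^sup>+x. ennreal (norm (K (Complex x y)) powr (p / 2)) \<partial>lebesgue) \<le> ennreal (M1 + M2)" if y: "0 < y" for y
    proof -
      have "(\<integral>\<^sup>+x. ennreal (norm (K (Complex x y)) powr (p / 2)) \<partial>lebesgue)
         \<le> (\<integral>\<^sup>+x. ennreal (norm (F (Complex x y)) powr p) + ennreal (norm (\<Psi> (Complex x y)) powr p) \<partial>lebesgue)"
      proof (intro nn_integral_mono)
        fix x
        have "norm (K (Complex x y)) powr (p / 2) \<le> norm (F (Complex x y)) powr p + norm (\<Psi> (Complex x y)) powr p"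
          unfolding K_def norm_mult by (intro powr_half_mult_le) auto
        then show "ennreal (norm (K (Complex x y)) powr (p / 2))
            \<le> ennreal (norm (F (Complex x y)) powr p) + ennreal (norm (\<Psi> (Complex x y)) powr p)"
          by (simp add: ennreal_plus[symmetric] ennreal_leI del: ennreal_plus)
      qed
      also have "\<dots> = (\<integral>\<^sup>+x. ennreal (norm (F (Complex x y)) powr p) \<partial>lebesgue)
          + (\<integral>\<^sup>+x. ennreal (norm (\<Psi> (Complex x y)) powr p) \<partial>lebesgue)"
        by (intro nn_integral_add line holF hol\<Psi> y)
      also have "\<dots> \<le> ennreal M1 + ennreal M2" by (intro add_mono M1 M2 y)
      finally show ?thesis using M1(1) M2(1) by simp
    qed
    show "boundary_values K (\<lambda>t. g t * \<psi> t)"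
      unfolding K_def by (intro boundary_values_mult F \<Psi>)
    show "AE t in lebesgue. 0 < u t \<and> norm (g t * \<psi> t) \<le> u t"
      using eq nz m0
    proof eventually_elim
      case (elim t)
      have "norm (g t * \<psi> t) = norm (Q t) * norm (W t) * norm (\<gamma> t)"
        using elim by (simp add: norm_mult norm_divide)
      also have "\<dots> \<le> u t" unfolding u_def m_def by (intro mult_left_mono) auto
      finally show ?case using elim by (simp add: u_def)
    qed
  qed (use p z iu M1 M2 in auto)
  \<comment> \<open>The extensions EQ and EW cancel the first two terms of ln u exactly. What
    remains is the Poisson integral of ln m with m in L^p, as the membership criterion
    requires.\<close>
  define G where "G z = K z / (EQ z * EW z)" for z
  have "G \<in> Hardy p"
  proof (rule mem_Hardy_if_le_exp_poisson_integral[OF _ _ _ m0 im mp])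
    have "EQ z * EW z \<noteq> 0" if "0 < Im z" for z
      using EQ(3)[OF that] EW(3)[OF that] by (metis exp_not_eq_zero mult_eq_0_iff norm_eq_zero)
    then show "G holomorphic_on upper_half_plane"
      unfolding G_def K_def by (intro holomorphic_intros holF hol\<Psi> EQ EW) auto
    fix z assume z: "0 < Im z"
    have i: "integrable lebesgue (\<lambda>t. ln (norm (Q t)) * poisson_kernel z t)"
      "integrable lebesgue (\<lambda>t. ln (norm (W t)) * poisson_kernel z t)"
      "integrable lebesgue (\<lambda>t. ln (m t) * poisson_kernel z t)"
      using integrable_mult_poisson_kernel[OF z _ iQ] integrable_mult_poisson_kernel[OF z _ iW]
        integrable_mult_poisson_kernel[OF z _ im] by simp_all
    have "(\<integral>t. ln (u t) * poisson_kernel z t \<partial>lebesgue)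
        = (\<integral>t. ln (norm (Q t)) * poisson_kernel z t + ln (norm (W t)) * poisson_kernel z t
              + ln (m t) * poisson_kernel z t \<partial>lebesgue)"
    proof (rule integral_cong_AE)
      show "AE t in lebesgue. ln (u t) * poisson_kernel z t = ln (norm (Q t)) * poisson_kernel z t
          + ln (norm (W t)) * poisson_kernel z t + ln (m t) * poisson_kernel z t"
        using lnu by eventually_elim (simp add: algebra_simps)
    qed measurable
    also have "\<dots> = (\<integral>t. ln (norm (Q t)) * poisson_kernel z t \<partial>lebesgue)
        + (\<integral>t. ln (norm (W t)) * poisson_kernel z t \<partial>lebesgue) + (\<integral>t. ln (m t) * poisson_kernel z t \<partial>lebesgue)"
      using i by simp
    finally have "norm (K z) \<le> norm (EQ z) * norm (EW z) * exp (\<integral>t. ln (m t) * poisson_kernel z t \<partial>lebesgue)"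
      using K[OF z] EQ(3)[OF z] EW(3)[OF z] by (simp add: exp_add)
    moreover have "0 < norm (EQ z) * norm (EW z)" using EQ(3)[OF z] EW(3)[OF z] by simp
    ultimately show "norm (G z) \<le> exp (\<integral>t. ln (m t) * poisson_kernel z t \<partial>lebesgue)"
      by (simp add: G_def norm_mult norm_divide pos_divide_le_eq mult.commute)
  qed (use p in auto)
  moreover have "boundary_values G \<gamma>"
  proof (rule boundary_values_cong_AE)
    show "boundary_values G (\<lambda>x. g x * \<psi> x / (Q x * W x))"
      unfolding G_def K_def using nz
      by (intro boundary_values_divide boundary_values_mult F \<Psi> EQ EW) auto
    show "AE x in lebesgue. g x * \<psi> x / (Q x * W x) = \<gamma> x" using eq by eventually_elim simp
  qed
  ultimately show ?thesis using \<gamma> by (auto simp: Hp_plus_def)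
qed

text \<open>The product of the two extensions has modulus exactly the exponential of the Poisson
  integral of ln |Q W|, so Jensen's inequality applies directly with m = |Q W|.\<close>

lemma outer_mult_mem_Hp_plus:
  assumes p: "0 < p" and Q: "outer_function Q" and W: "outer_function W"
    and QW: "(\<lambda>x. Q x * W x) \<in> Lp p"
  shows "(\<lambda>x. Q x * W x) \<in> Hp_plus p"
proof -
  obtain EQ where EQ: "EQ holomorphic_on upper_half_plane" "boundary_values EQ Q"
    "\<And>z. 0 < Im z \<Longrightarrow> norm (EQ z) = exp (\<integral>t. ln (norm (Q t)) * poisson_kernel z t \<partial>lebesgue)"
    using outer_function_extension[OF Q] by metis
  obtain EW where EW: "EW holomorphic_on upper_half_plane" "boundary_values EW W"
    "\<And>z. 0 < Im z \<Longrightarrow> norm (EW z) = exp (\<integral>t. ln (norm (W t)) * poisson_kernel z t \<partial>lebesgue)"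
    using outer_function_extension[OF W] by metis
  have [measurable]: "Q \<in> borel_measurable lebesgue" "W \<in> borel_measurable lebesgue"
    using Q W by (auto simp: outer_function_def)
  have nz: "AE x in lebesgue. Q x \<noteq> 0" "AE x in lebesgue. W x \<noteq> 0"
    using Q W by (auto simp: outer_function_def)
  have iQ: "integrable lebesgue (\<lambda>t. \<bar>ln (norm (Q t))\<bar> / (1 + t\<^sup>2))"
    and iW: "integrable lebesgue (\<lambda>t. \<bar>ln (norm (W t))\<bar> / (1 + t\<^sup>2))"
    using Q W by (auto simp: outer_function_def)
  have ln: "AE t in lebesgue. ln (norm (Q t * W t)) = ln (norm (Q t)) + ln (norm (W t))"
    using nz by eventually_elim (simp add: norm_mult ln_mult)
  have "(\<lambda>z. EQ z * EW z) \<in> Hardy p"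
  proof (rule mem_Hardy_if_le_exp_poisson_integral[OF _ p])
    show "(\<lambda>z. EQ z * EW z) holomorphic_on upper_half_plane" by (intro holomorphic_intros EQ EW)
    show "AE t in lebesgue. 0 < norm (Q t * W t)" using nz by eventually_elim simp
    show "integrable lebesgue (\<lambda>t. norm (Q t * W t) powr p)" using QW by (simp add: Lp_def)
    show "integrable lebesgue (\<lambda>t. \<bar>ln (norm (Q t * W t))\<bar> / (1 + t\<^sup>2))"
    proof (rule Bochner_Integration.integrable_bound)
      show "integrable lebesgue (\<lambda>t. \<bar>ln (norm (Q t))\<bar> / (1 + t\<^sup>2) + \<bar>ln (norm (W t))\<bar> / (1 + t\<^sup>2))"
        using iQ iW by simp
      show "AE t in lebesgue. norm (\<bar>ln (norm (Q t * W t))\<bar> / (1 + t\<^sup>2))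
          \<le> norm (\<bar>ln (norm (Q t))\<bar> / (1 + t\<^sup>2) + \<bar>ln (norm (W t))\<bar> / (1 + t\<^sup>2))"
        using ln
      proof eventually_elim
        case (elim t)
        have "\<bar>ln (norm (Q t * W t))\<bar> / (1 + t\<^sup>2) \<le> (\<bar>ln (norm (Q t))\<bar> + \<bar>ln (norm (W t))\<bar>) / (1 + t\<^sup>2)"
          unfolding elim by (intro divide_right_mono) auto
        then show ?case by (simp add: add_divide_distrib)
      qed
    qed measurable
    fix z assume z: "0 < Im z"
    have i: "integrable lebesgue (\<lambda>t. ln (norm (Q t)) * poisson_kernel z t)"
      "integrable lebesgue (\<lambda>t. ln (norm (W t)) * poisson_kernel z t)"
      using integrable_mult_poisson_kernel[OF z _ iQ] integrable_mult_poisson_kernel[OF z _ iW] by simp_all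
    have "(\<integral>t. ln (norm (Q t * W t)) * poisson_kernel z t \<partial>lebesgue)
        = (\<integral>t. ln (norm (Q t)) * poisson_kernel z t + ln (norm (W t)) * poisson_kernel z t \<partial>lebesgue)"
    proof (rule integral_cong_AE)
      show "AE t in lebesgue. ln (norm (Q t * W t)) * poisson_kernel z t
          = ln (norm (Q t)) * poisson_kernel z t + ln (norm (W t)) * poisson_kernel z t"
        using ln by eventually_elim (simp only: distrib_right)
    qed measurable
    then show "norm (EQ z * EW z) \<le> exp (\<integral>t. ln (norm (Q t * W t)) * poisson_kernel z t \<partial>lebesgue)"
      using i by (simp add: norm_mult EQ(3)[OF z] EW(3)[OF z] exp_add)
  qed measurable
  moreover have "boundary_values (\<lambda>z. EQ z * EW z) (\<lambda>x. Q x * W x)"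
    by (intro boundary_values_mult EQ EW)
  ultimately show ?thesis using QW by (auto simp: Hp_plus_def)
qed

section \<open>Toeplitz kernels as membership conditions\<close>

lemma zero_mem_Hp_plus: "(\<lambda>_. 0) \<in> Hp_plus p"
proof -
  have "(\<lambda>_. 0) \<in> Hardy p" by (simp add: Hardy_def)
  moreover have "boundary_values (\<lambda>_. 0) (\<lambda>_. 0)" by (simp add: boundary_values_def)
  ultimately show ?thesis by (auto simp: Hp_plus_def Lp_def)
qed

lemma mem_toeplitz_kernel_iff:
  "\<phi> \<in> toeplitz_kernel p g \<longleftrightarrow>
     \<phi> \<in> Hp_plus p \<and> (\<lambda>x. g x * \<phi> x) \<in> Lp p \<and> (\<lambda>x. cnj (g x * \<phi> x)) \<in> Hp_plus p"
  by (auto simp: toeplitz_kernel_def toeplitz_def toeplitz_domain_def riesz_projection_def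
      Hp_minus_def zero_mem_Hp_plus)

lemma Lp_cnj_iff: "(\<lambda>x. cnj (f x)) \<in> Lp p \<longleftrightarrow> f \<in> Lp p"
proof -
  have cnj: "cnj \<in> borel_measurable borel"
    by (intro borel_measurable_continuous_onI continuous_intros)
  have *: "(\<lambda>x. cnj (h x)) \<in> borel_measurable lebesgue" if "h \<in> borel_measurable lebesgue" for h :: "real \<Rightarrow> complex"
    using that cnj by (rule measurable_compose)
  have "(\<lambda>x. cnj (f x)) \<in> borel_measurable lebesgue \<longleftrightarrow> f \<in> borel_measurable lebesgue"
    using *[of f] *[of "\<lambda>x. cnj (f x)"] by (simp only: complex_cnj_cnj) blast
  then show ?thesis by (simp add: Lp_def)
qed

section \<open>Minimal kernels\<close>

theorem theorem4p1:
  fixes p :: real and f_plus I_plus O_plus Q :: "real \<Rightarrow> complex"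
  assumes "1 < p"
    and "f_plus \<in> Hp_plus p"
    and "\<not> (AE x in lebesgue. f_plus x = 0)"
    and "inner_function I_plus"
    and "outer_function O_plus"
    and "O_plus \<in> Hp_plus p"
    and "AE x in lebesgue. f_plus x = I_plus x * O_plus x"
    and "outer_function Q"
    and "\<exists>\<delta>>0. AE x in lebesgue. \<delta> \<le> norm (Q x)"
    and "(\<lambda>x. Q x * f_plus x) \<in> Hp_plus p"
  shows "(\<exists>K. is_min_kernel p Q f_plus K) \<and>
    K_min p Q f_plus =
      toeplitz_kernel p (\<lambda>x. cnj (Q x) * (cnj (I_plus x) * cnj (O_plus x) / O_plus x))"
proof -
  define k where "k x = cnj (Q x) * (cnj (I_plus x) * cnj (O_plus x) / O_plus x)" for x
  have p: "0 < p" "0 \<le> p" using assms(1) by auto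
  have cnj[measurable]: "cnj \<in> borel_measurable borel"
    by (intro borel_measurable_continuous_onI continuous_intros)
  have [measurable]: "Q \<in> borel_measurable lebesgue" "I_plus \<in> borel_measurable lebesgue"
    "O_plus \<in> borel_measurable lebesgue" "f_plus \<in> borel_measurable lebesgue"
    using assms by (auto simp: outer_function_def inner_function_def Hp_plus_def Lp_def)
  have k_meas[measurable]: "k \<in> borel_measurable lebesgue" unfolding k_def by measurable
  have nzQ: "AE x in lebesgue. Q x \<noteq> 0" and nzO: "AE x in lebesgue. O_plus x \<noteq> 0"
    and I1: "AE x in lebesgue. norm (I_plus x) = 1"
    using assms by (auto simp: outer_function_def inner_function_def)
  have norm_k: "AE x in lebesgue. norm (k x) = norm (Q x)"
    using nzO I1 by eventually_elim (simp add: k_def norm_mult norm_divide)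
  \<comment> \<open>The inner factor disappears through |I| = 1, and the denominator of
    \<open>k\<close> cancels the outer factor of \<open>f_plus\<close>.\<close>
  have kf: "AE x in lebesgue. cnj (k x * f_plus x) = Q x * O_plus x"
    using nzO I1 assms(7)
  proof eventually_elim
    case (elim x)
    have "I_plus x * cnj (I_plus x) = 1" using elim(2) by (simp add: complex_norm_square[symmetric])
    then show ?case using elim by (simp add: k_def field_simps)
  qed
  have Qf: "(\<lambda>x. Q x * f_plus x) \<in> Lp p" using assms(10) by (simp add: Hp_plus_def)
  \<comment> \<open>|Q O| = |Q f| almost everywhere, again by |I| = 1.\<close>
  have "(\<lambda>x. Q x * O_plus x) \<in> Lp p"
  proof (rule Lp_bound[OF Qf _ p(2) zero_le_one])
    show "AE x in lebesgue. norm (Q x * O_plus x) \<le> 1 * norm (Q x * f_plus x)"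
      using assms(7) I1 by eventually_elim (simp add: norm_mult)
  qed measurable
  then have "(\<lambda>x. Q x * O_plus x) \<in> Hp_plus p"
    by (rule outer_mult_mem_Hp_plus[OF p(1) assms(8) assms(5)])
  then have kf_cnj: "(\<lambda>x. cnj (k x * f_plus x)) \<in> Hp_plus p"
    by (rule Hp_plus_cong_AE[OF _ _ p(2)]) (measurable, use kf in \<open>auto elim: eventually_mono\<close>)
  then have "(\<lambda>x. cnj (k x * f_plus x)) \<in> Lp p" by (simp add: Hp_plus_def)
  then have kf_Lp: "(\<lambda>x. k x * f_plus x) \<in> Lp p" by (rule Lp_cnj_iff[THEN iffD1])
  have f_ker: "f_plus \<in> toeplitz_kernel p k"
    using assms(2) kf_cnj kf_Lp by (simp add: mem_toeplitz_kernel_iff)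
  have k_sigma: "k \<in> sigma_class Q"
    unfolding sigma_class_def
  proof (intro CollectI conjI k_meas exI[of _ 2])
    \<comment> \<open>The inequality in the symbol class is strict while |k| = |Q|; any constant
      above 1 works, because Q is nonzero almost everywhere.\<close>
    show "AE x in lebesgue. norm (k x) < 2 * norm (Q x)"
      using norm_k nzQ by eventually_elim simp
  qed simp
  have k_symbol: "toeplitz_symbol p k"
    unfolding toeplitz_symbol_def using assms(2,3) kf_Lp k_meas by blast
  have minimal: "toeplitz_kernel p k \<subseteq> toeplitz_kernel p h"
    if h: "h \<in> sigma_class Q" and fh: "f_plus \<in> toeplitz_kernel p h" for h
  proof
    fix \<phi> assume "\<phi> \<in> toeplitz_kernel p k"
    then have \<phi>: "\<phi> \<in> Hp_plus p" "(\<lambda>x. k x * \<phi> x) \<in> Lp p" "(\<lambda>x. cnj (k x * \<phi> x)) \<in> Hp_plus p"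
      by (auto simp: mem_toeplitz_kernel_iff)
    obtain c where [measurable]: "h \<in> borel_measurable lebesgue" and c: "0 < c"
      and hc: "AE x in lebesgue. norm (h x) < c * norm (Q x)"
      using h by (auto simp: sigma_class_def)
    have [measurable]: "\<phi> \<in> borel_measurable lebesgue" using \<phi>(1) by (simp add: Hp_plus_def Lp_def)
    have h\<phi>: "(\<lambda>x. h x * \<phi> x) \<in> Lp p"
    proof (rule Lp_bound[OF \<phi>(2) _ p(2) less_imp_le[OF c]])
      show "AE x in lebesgue. norm (h x * \<phi> x) \<le> c * norm (k x * \<phi> x)"
        using hc norm_k
      proof eventually_elim
        case (elim x)
        then have "norm (h x) * norm (\<phi> x) \<le> c * norm (k x) * norm (\<phi> x)"
          by (intro mult_right_mono) auto
        then show ?case by (simp add: norm_mult mult.assoc)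
      qed
    qed measurable
    have "(\<lambda>x. cnj (h x * \<phi> x)) \<in> Hp_plus p"
    \<comment> \<open>The two factors of the numerator are the conjugates of
      \<open>h * f_plus\<close> and \<open>k * \<phi>\<close>, both in H^p by the kernel conditions;
      the outer denominators are \<open>Q\<close> and \<open>O_plus\<close>.\<close>
    proof (rule smirnov_quotient_mem_Hp_plus[OF assms(1) _ \<phi>(3) assms(8,5)])
      show "(\<lambda>x. cnj (h x * f_plus x)) \<in> Hp_plus p" using fh by (simp add: mem_toeplitz_kernel_iff)
      show "O_plus \<in> Lp p" using assms(6) by (simp add: Hp_plus_def)
      show "(\<lambda>x. cnj (h x * \<phi> x)) \<in> Lp p" using h\<phi> by (rule Lp_cnj_iff[THEN iffD2])
      show "AE x in lebesgue. cnj (h x * \<phi> x)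
          = cnj (h x * f_plus x) * cnj (k x * \<phi> x) / (Q x * O_plus x)"
        using kf nzQ nzO
      proof eventually_elim
        case (elim x)
        \<comment> \<open>Exchanging \<open>f_plus\<close> and \<phi> between the two factors
          produces \<open>cnj (k x * f_plus x)\<close>, which is the denominator.\<close>
        have "cnj (h x * f_plus x) * cnj (k x * \<phi> x) = cnj (h x * \<phi> x) * cnj (k x * f_plus x)"
          by (simp add: mult_ac)
        then show ?case using elim by (simp only: elim(1)) simp
      qed
    qed
    then show "\<phi> \<in> toeplitz_kernel p h" using \<phi>(1) h\<phi> by (simp add: mem_toeplitz_kernel_iff)
  qed
  have min: "is_min_kernel p Q f_plus (toeplitz_kernel p k)"
    unfolding is_min_kernel_def using k_sigma k_symbol f_ker minimal by blast
  have "K_min p Q f_plus = toeplitz_kernel p k"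
    unfolding K_min_def
  \<comment> \<open>Any minimal kernel contains \<open>f_plus\<close> and comes from an admissible
    symbol, so it and the kernel of \<open>k\<close> contain each other by their respective
    minimality.\<close>
  proof (rule the_equality[where P = "is_min_kernel p Q f_plus", OF min])
    fix K assume K: "is_min_kernel p Q f_plus K"
    then obtain k' where k': "k' \<in> sigma_class Q" "toeplitz_symbol p k'" "K = toeplitz_kernel p k'"
      "f_plus \<in> K"
      by (auto simp: is_min_kernel_def)
    have "toeplitz_kernel p k \<subseteq> K" using minimal[OF k'(1)] k'(3,4) by simp
    moreover have "K \<subseteq> toeplitz_kernel p k"
      using K k_sigma k_symbol f_ker unfolding is_min_kernel_def by blast
    ultimately show "K = toeplitz_kernel p k" by simp
  qed
  then show ?thesis using min unfolding k_def[abs_def] by blast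
qed

end
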